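(* Let $\gamma:\mathbb R/L\mathbb Z\to\mathbb R^3$ be a closed $C^\infty$ unit-speed embedded curve with curvature $\kappa>0$ everywhere and torsion $\tau$, and let $d=(\kappa,|\tau|)$ be its unsigned Frenet datum. Then: (1) (One-dimensional classification.) The map sending a locally constant function $\varepsilon: S^1\setminus Z_\infty(\tau)\to\{\pm1\}$ to the function equal to $\varepsilon\tau$ on $S^1\setminus Z_\infty(\tau)$ and to $0$ on $Z_\infty(\tau)$ is a bijection onto $\mathcal L(\tau)$; hence $|\mathcal L(\tau)|=2^{c(\tau)}$. Moreover $\mathcal L(\tau)=\{\tau,-\tau\}$ if and only if $c(\tau)\le 1$. (2) (Geometric consequence.) $|\mathrm{Fib}_{SE}(d)|\le 2^{c(\tau)}$, and therefore also $|\mathcal F(d)|\le 2^{c(\tau)}$. (3) (Rigidity.) Whenever $c(\tau)\le1$, every $\widetilde\gamma\in\mathrm{Fib}(d)$ equals $Q\gamma+a$ for some $Q\in O(3)$ and $a\in\mathbb R^3$; thus $|\mathrm{Fib}_E(d)|=1$ and $|\mathrm{Fib}_{SE}(d)|\le2$, the two classes (when there are two) being exchanged by a reflection. This holds in particular whenever every zero of $\tau$ has finite order, and whenever $\gamma$ is real-analytic.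
   Context: $S^1=\mathbb R/L\mathbb Z$ with arclength parameter. Curves: $C^\infty$, unit speed, injective maps $\gamma:\mathbb R/L\mathbb Z\to\mathbb R^3$ with $\kappa=|\gamma''|>0$ everywhere. Frenet frame: $T=\gamma'$, $N=T'/\kappa$, $B=T\times N$, $T'=\kappa N$, $N'=-\kappa T+\tau B$, $B'=-\tau N$, which fixes the sign of the torsion $\tau\in C^\infty(S^1)$. The order of a zero $p$ of a smooth $f$ is $\min\{k:f^{(k)}(p)\ne0\}\in\mathbb N\cup\{\infty\}$. $Z_\infty(\tau)=\{s\in S^1:\tau^{(k)}(s)=0\ \text{for all }k\ge0\}$; $c(\tau)\in\mathbb N_0\cup\{\aleph_0\}$ is the number of connected components of $S^1\setminus Z_\infty(\tau)$ (if $Z_\infty(\tau)=\varnothing$ the single component is $S^1$; $c(\tau)=0$ iff $\tau\equiv0$). $\mathcal L(\tau)=\{g\in C^\infty(S^1):|g(s)|=|\tau(s)|\ \text{for all }s\}$ is the set of smooth signed lifts of $|\tau|$. Cardinal exponentiation is used, $2^0=1$. For a datum $d=(\kappa_0,|\tau_0|)$ on $\mathbb R/L\mathbb Z$, $\mathrm{Fib}(d)$ is the set of $C^\infty$, unit-speed, injective curves $\widetilde\gamma:\mathbb R/L\mathbb Z\to\mathbb R^3$ with curvature $\kappa_{\widetilde\gamma}>0$ everywhere and with $(\kappa_{\widetilde\gamma}(s),|\tau_{\widetilde\gamma}(s)|)=d(s)$ for all $s$ (same arclength label, no reparametrisation allowed). $\mathrm{Fib}_{SE}(d)=\mathrm{Fib}(d)/SE(3)$,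 $\mathrm{Fib}_E(d)=\mathrm{Fib}(d)/E(3)$, where $SE(3)$ is the group of orientation-preserving rigid motions and $E(3)=O(3)\ltimes\mathbb R^3$; $\mathcal F(d)$ is the set of knot types (ambient isotopy classes of the images, unoriented, ambient isotopy not including mirroring) of the curves in $\mathrm{Fib}(d)$. *)

theory Defs
  imports "HOL-Analysis.Analysis"
begin

unbundle cardinal_syntax

text \<open>
  Functions on \<open>\<real>/L\<int>\<close> are \<open>L\<close>-periodic functions on \<open>\<real>\<close>. Where the topology of \<open>S\<^sup>1 = \<real>/L\<int>\<close>
  itself matters (connected components, local constancy), \<open>S\<^sup>1\<close> is the unit circle of the complex
  plane, and \<open>circ L\<close> is the covering map \<open>\<real> \<rightarrow> S\<^sup>1\<close> inducing \<open>\<real>/L\<int> \<cong> S\<^sup>1\<close>.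
\<close>

abbreviation S1 :: "complex set" where
  "S1 \<equiv> sphere 0 1"

definition circ :: "real \<Rightarrow> real \<Rightarrow> complex" where
  "circ L s = cis (2 * pi * s / L)"

definition periodic :: "real \<Rightarrow> (real \<Rightarrow> 'a) \<Rightarrow> bool" where
  "periodic L f \<longleftrightarrow> (\<forall>s. f (s + L) = f s)"

abbreviation Dv :: "(real \<Rightarrow> 'a::real_normed_vector) \<Rightarrow> real \<Rightarrow> 'a" where
  "Dv f \<equiv> (\<lambda>s. vector_derivative f (at s))"

definition nth_deriv :: "nat \<Rightarrow> (real \<Rightarrow> 'a::real_normed_vector) \<Rightarrow> real \<Rightarrow> 'a" where
  "nth_deriv k f = (Dv ^^ k) f"

definition smooth :: "(real \<Rightarrow> 'a::real_normed_vector) \<Rightarrow> bool" where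
  "smooth f \<longleftrightarrow> (\<forall>k s. nth_deriv k f differentiable at s)"

definition real_analytic :: "(real \<Rightarrow> 'a::real_normed_vector) \<Rightarrow> bool" where
  "real_analytic f \<longleftrightarrow>
     (\<forall>p. \<exists>r>0. \<exists>a :: nat \<Rightarrow> 'a. \<forall>s. \<bar>s - p\<bar> < r \<longrightarrow> (\<lambda>k. (s - p) ^ k *\<^sub>R a k) sums f s)"


section \<open>Frenet apparatus\<close>

definition tangent :: "(real \<Rightarrow> real^3) \<Rightarrow> real \<Rightarrow> real^3" where
  "tangent \<gamma> = Dv \<gamma>"

definition curvature :: "(real \<Rightarrow> real^3) \<Rightarrow> real \<Rightarrow> real" where
  "curvature \<gamma> s = norm (nth_deriv 2 \<gamma> s)"

definition normal :: "(real \<Rightarrow> real^3) \<Rightarrow> real \<Rightarrow> real^3" where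
  "normal \<gamma> s = Dv (tangent \<gamma>) s /\<^sub>R curvature \<gamma> s"

definition binormal :: "(real \<Rightarrow> real^3) \<Rightarrow> real \<Rightarrow> real^3" where
  "binormal \<gamma> s = cross3 (tangent \<gamma> s) (normal \<gamma> s)"

text \<open>The torsion is the coefficient determined by \<open>B' = -\<tau> N\<close>.\<close>

definition torsion :: "(real \<Rightarrow> real^3) \<Rightarrow> real \<Rightarrow> real" where
  "torsion \<gamma> s = - (Dv (binormal \<gamma>) s \<bullet> normal \<gamma> s)"

definition frenet_curve :: "real \<Rightarrow> (real \<Rightarrow> real^3) \<Rightarrow> bool" where
  "frenet_curve L \<gamma> \<longleftrightarrow>
     smooth \<gamma> \<and> periodic L \<gamma> \<and> inj_on \<gamma> {0..<L} \<and>
     (\<forall>s. norm (Dv \<gamma> s) = 1) \<and> (\<forall>s. curvature \<gamma> s > 0)"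


section \<open>Zeros of infinite order and signed lifts\<close>

text \<open>The infimum of the empty set in \<open>enat\<close> is \<open>\<infinity>\<close>.\<close>

definition zero_order :: "(real \<Rightarrow> real) \<Rightarrow> real \<Rightarrow> enat" where
  "zero_order f p = (INF k \<in> {k. nth_deriv k f p \<noteq> 0}. enat k)"

definition Z_inf :: "real \<Rightarrow> (real \<Rightarrow> real) \<Rightarrow> complex set" where
  "Z_inf L f = circ L ` {s. \<forall>k. nth_deriv k f s = 0}"

definition num_comps :: "real \<Rightarrow> (real \<Rightarrow> real) \<Rightarrow> complex set rel" where
  "num_comps L f = |components (S1 - Z_inf L f)|"

definition signed_lifts :: "real \<Rightarrow> (real \<Rightarrow> real) \<Rightarrow> (real \<Rightarrow> real) set" where
  "signed_lifts L f = {g. smooth g \<and> periodic L g \<and> (\<forall>s. \<bar>g s\<bar> = \<bar>f s\<bar>)}"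

text \<open>Locally constant functions \<open>U \<rightarrow> {\<plusminus>1}\<close>; extensionality makes them determined by their
  values on \<open>U\<close>.\<close>

definition sign_functions :: "complex set \<Rightarrow> (complex \<Rightarrow> real) set" where
  "sign_functions U = {\<epsilon> \<in> U \<rightarrow>\<^sub>E {1, -1}. locally (\<lambda>V. \<epsilon> constant_on V) U}"

definition apply_signs :: "real \<Rightarrow> (real \<Rightarrow> real) \<Rightarrow> (complex \<Rightarrow> real) \<Rightarrow> real \<Rightarrow> real" where
  "apply_signs L f \<epsilon> = (\<lambda>s. if circ L s \<in> Z_inf L f then 0 else \<epsilon> (circ L s) * f s)"


section \<open>Fibres over an unsigned Frenet datum\<close>

definition Fib :: "real \<Rightarrow> (real \<Rightarrow> real) \<times> (real \<Rightarrow> real) \<Rightarrow> (real \<Rightarrow> real^3) set" where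
  "Fib L d = {\<gamma>. frenet_curve L \<gamma> \<and> (\<forall>s. (curvature \<gamma> s, \<bar>torsion \<gamma> s\<bar>) = (fst d s, snd d s))}"

definition SE3 :: "(real^3 \<Rightarrow> real^3) set" where
  "SE3 = {\<lambda>x. Q *v x + a | Q a. rotation_matrix Q}"

definition E3 :: "(real^3 \<Rightarrow> real^3) set" where
  "E3 = {\<lambda>x. Q *v x + a | Q a. orthogonal_matrix Q}"

definition Fib_mod :: "(real^3 \<Rightarrow> real^3) set \<Rightarrow> real \<Rightarrow> (real \<Rightarrow> real) \<times> (real \<Rightarrow> real)
    \<Rightarrow> (real \<Rightarrow> real^3) set set" where
  "Fib_mod G L d = Fib L d // {(\<gamma>, \<gamma>'). \<gamma> \<in> Fib L d \<and> \<gamma>' \<in> Fib L d \<and> (\<exists>g\<in>G. \<gamma>' = g \<circ> \<gamma>)}"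

abbreviation Fib_SE :: "real \<Rightarrow> (real \<Rightarrow> real) \<times> (real \<Rightarrow> real) \<Rightarrow> (real \<Rightarrow> real^3) set set" where
  "Fib_SE \<equiv> Fib_mod SE3"

abbreviation Fib_E :: "real \<Rightarrow> (real \<Rightarrow> real) \<times> (real \<Rightarrow> real) \<Rightarrow> (real \<Rightarrow> real^3) set set" where
  "Fib_E \<equiv> Fib_mod E3"

text \<open>Reflection in the plane through \<open>p\<close> with unit normal \<open>n\<close>.\<close>

definition reflections :: "(real^3 \<Rightarrow> real^3) set" where
  "reflections = {\<lambda>x. x - (2 * ((x - p) \<bullet> n)) *\<^sub>R n | p n. norm n = 1}"


section \<open>Knot types\<close>

text \<open>A homotopy through homeomorphisms of \<open>\<real>\<^sup>3\<close>, starting at the identity and carrying \<open>K\<close> to \<open>K'\<close>.\<close>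

definition ambient_isotopic :: "(real^3) set \<Rightarrow> (real^3) set \<Rightarrow> bool" where
  "ambient_isotopic K K' \<longleftrightarrow>
     (\<exists>h. homotopic_with_canon (\<lambda>f. \<exists>g. homeomorphism UNIV UNIV f g) UNIV UNIV id h \<and> h ` K = K')"

definition knot_type :: "(real^3) set \<Rightarrow> (real^3) set set" where
  "knot_type K = {K'. ambient_isotopic K K'}"

definition knot_types :: "real \<Rightarrow> (real \<Rightarrow> real) \<times> (real \<Rightarrow> real) \<Rightarrow> (real^3) set set set" where
  "knot_types L d = (\<lambda>\<gamma>. knot_type (range \<gamma>)) ` Fib L d"

end

theory Submission
  imports Defs
begin

text \<open>
  If \<open>g\<close> is smooth with \<open>\<bar>g\<bar> = \<bar>\<tau>\<bar>\<close> then \<open>(g - \<tau>) (g + \<tau>) = 0\<close>. By Rolle's theorem a limit point of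
  zeros of a smooth function is a zero of infinite order; so at a point where \<open>\<tau>\<close> is not flat the
  zeros of \<open>g - \<tau>\<close> and of \<open>g + \<tau>\<close> cannot both accumulate, and \<open>g = \<tau>\<close> or \<open>g = -\<tau>\<close> nearby. Conversely,
  signs may be changed independently across flat points without losing smoothness. The torsions
  occurring in the fibre are signed lifts of \<open>\<bar>\<tau>\<bar>\<close>, and curvature and torsion determine the curve up
  to \<open>SE(3)\<close>. Knot types are invariant under \<open>SE(3)\<close> because a rotation is a product of pairs of
  reflections \<open>r\<^sub>n r\<^sub>m\<close>, and moving \<open>m\<close> to \<open>n\<close> on the sphere deforms such a pair to the identity. For a
  real-analytic curve the set of flat points of \<open>\<tau>\<close> is open and closed.
\<close>

text \<open>At a zero of finite order of \<tau> the quotient \<open>g / \<tau>\<close> has no value,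
  yet components of the complement of the flat set run through such zeros. The sign is therefore
  read off from germs: it is 1 where \<open>g - \<tau>\<close> is flat and -1 elsewhere. Smooth
  functions live on the real line, components on the circle; \<open>circ L\<close> is continuous and
  open, so local constancy can be carried in both directions. Components of an open subset of the
  circle are open, so a locally constant sign is a free choice on each component. This yields the
  power of two as a cardinal identity, with no case distinction between finitely and infinitely many
  components. An isometry of determinant \<delta> multiplies torsion by \<delta>. The lift
  \<open>-\<tau>\<close> is thus realised by the mirror image, and when only two lifts exist every
  curve of the fibre is congruent to the given one or to its mirror image.\<close>

section \<open>Smooth functions of a real variable\<close>

lemma nth_deriv_0 [simp]: "nth_deriv 0 f = f"
  by (simp add: nth_deriv_def)

lemma nth_deriv_Suc: "nth_deriv (Suc k) f = Dv (nth_deriv k f)"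
  by (simp add: nth_deriv_def)

lemma nth_deriv_Suc': "nth_deriv (Suc k) f = nth_deriv k (Dv f)"
  by (simp only: nth_deriv_def funpow_Suc_right o_def)

text \<open>Smoothness is defined through iterates, for which products and quotients would require
  closed formulas. Peeling off one derivative at a time makes every closure property an induction:
  the derivative of the compound is again a compound of functions with one order less to
  spare.\<close>

primrec differentiable_order :: "nat \<Rightarrow> (real \<Rightarrow> 'a::real_normed_vector) \<Rightarrow> bool" where
  "differentiable_order 0 f = True"
| "differentiable_order (Suc n) f =
    ((\<forall>s. f differentiable at s) \<and> differentiable_order n (Dv f))"

lemma differentiable_order_iff:
  "differentiable_order n f \<longleftrightarrow> (\<forall>k<n. \<forall>s. nth_deriv k f differentiable at s)"
proof (induction n arbitrary: f)
  case (Suc n)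
  have "(\<forall>k<Suc n. \<forall>s. nth_deriv k f differentiable at s) \<longleftrightarrow>
      (\<forall>s. f differentiable at s) \<and> (\<forall>k<n. \<forall>s. nth_deriv (Suc k) f differentiable at s)"
    by (simp add: All_less_Suc2)
  then show ?case
    by (simp add: Suc nth_deriv_Suc')
qed simp

lemma smooth_iff_differentiable_order: "smooth f \<longleftrightarrow> (\<forall>n. differentiable_order n f)"
  unfolding smooth_def differentiable_order_iff by auto

lemma smooth_Dv: "smooth f \<Longrightarrow> smooth (Dv f)"
  unfolding smooth_def by (metis nth_deriv_Suc')

lemma smooth_nth_deriv: "smooth f \<Longrightarrow> smooth (nth_deriv k f)"
  by (induction k) (auto simp: nth_deriv_Suc smooth_Dv)

lemma smooth_has_vector_derivative: "smooth f \<Longrightarrow> (f has_vector_derivative Dv f s) (at s)"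
  by (metis smooth_def nth_deriv_0 vector_derivative_works)

lemma smooth_has_real_derivative:
  fixes f :: "real \<Rightarrow> real"
  shows "smooth f \<Longrightarrow> (f has_real_derivative Dv f s) (at s)"
  by (simp add: has_real_derivative_iff_has_vector_derivative smooth_has_vector_derivative)

lemma smooth_isCont: "smooth f \<Longrightarrow> isCont f s"
  by (metis has_vector_derivative_continuous smooth_has_vector_derivative)

lemma Dv_eqI: "(\<And>s. (f has_vector_derivative f' s) (at s)) \<Longrightarrow> Dv f = f'"
  by (auto intro!: vector_derivative_at)

lemma differentiable_order_SucI:
  assumes "\<And>s. (f has_vector_derivative f' s) (at s)" "differentiable_order n f'"
  shows "differentiable_order (Suc n) f"
  using assms Dv_eqI[OF assms(1)] by (auto intro: differentiableI_vector)

lemma differentiable_order_SucD: "differentiable_order (Suc n) f \<Longrightarrow> differentiable_order n f"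
  unfolding differentiable_order_iff by auto

lemma differentiable_order_has_vector_derivative:
  "differentiable_order (Suc n) f \<Longrightarrow> (f has_vector_derivative Dv f s) (at s)"
  by (simp add: vector_derivative_works)

lemma differentiable_order_const: "differentiable_order n (\<lambda>s. c)"
proof (induction n arbitrary: c)
  case (Suc n)
  then show ?case by (intro differentiable_order_SucI[where f' = "\<lambda>s. 0"]) auto
qed simp

lemma differentiable_order_linear:
  assumes "bounded_linear h"
  shows "differentiable_order n f \<Longrightarrow> differentiable_order n (\<lambda>s. h (f s))"
proof (induction n arbitrary: f)
  case (Suc n)
  then show ?case
    by (intro differentiable_order_SucI[where f' = "\<lambda>s. h (Dv f s)"]
        bounded_linear.has_vector_derivative[OF assms] differentiable_order_has_vector_derivative)
      auto
qed simp

lemma differentiable_order_add: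
  "differentiable_order n f \<Longrightarrow> differentiable_order n g \<Longrightarrow> differentiable_order n (\<lambda>s. f s + g s)"
proof (induction n arbitrary: f g)
  case (Suc n)
  have "((\<lambda>s. f s + g s) has_vector_derivative Dv f s + Dv g s) (at s)" for s
    by (intro has_vector_derivative_add
        Suc.prems[THEN differentiable_order_has_vector_derivative])
  then show ?case
    using Suc by (intro differentiable_order_SucI) auto
qed simp

lemma differentiable_order_bilinear:
  assumes "bounded_bilinear h"
  shows "differentiable_order n f \<Longrightarrow> differentiable_order n g \<Longrightarrow>
    differentiable_order n (\<lambda>s. h (f s) (g s))"
proof (induction n arbitrary: f g)
  case (Suc n)
  have deriv: "((\<lambda>s. h (f s) (g s)) has_vector_derivative h (f s) (Dv g s) + h (Dv f s) (g s)) (at s)" for s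
    by (intro bounded_bilinear.has_vector_derivative[OF assms]
        Suc.prems[THEN differentiable_order_has_vector_derivative])
  have "differentiable_order n f" "differentiable_order n g"
      "differentiable_order n (Dv f)" "differentiable_order n (Dv g)"
    using Suc.prems differentiable_order_SucD by auto
  then show ?case
    using Suc.IH by (intro differentiable_order_SucI[OF deriv] differentiable_order_add)
qed simp

text \<open>The derivative of \<open>1/f\<close> is \<open>-(1/f) * f' * (1/f)\<close>, so
  \<open>1/f\<close> itself reappears. This is harmless, because the induction hypothesis supplies
  it with order \<open>n\<close>, which is all that the derivative needs.\<close>

lemma differentiable_order_inverse:
  fixes f :: "real \<Rightarrow> real"
  assumes "\<And>s. f s \<noteq> 0"
  shows "differentiable_order n f \<Longrightarrow> differentiable_order n (\<lambda>s. inverse (f s))"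
proof (induction n)
  case (Suc n)
  have "(f has_real_derivative Dv f s) (at s)" for s
    using differentiable_order_has_vector_derivative[OF Suc.prems]
    by (simp add: has_real_derivative_iff_has_vector_derivative)
  then have deriv: "((\<lambda>s. inverse (f s)) has_real_derivative
      - (inverse (f s) * (Dv f s * inverse (f s)))) (at s)" for s
    using DERIV_inverse'[of f "Dv f s" s UNIV] assms by (simp add: algebra_simps)
  have "differentiable_order n (\<lambda>s. inverse (f s))"
    using Suc differentiable_order_SucD by blast
  moreover have "differentiable_order n (Dv f)"
    using Suc.prems by simp
  ultimately show ?case
    by (intro differentiable_order_SucI[OF deriv[unfolded has_real_derivative_iff_has_vector_derivative]]
        differentiable_order_linear[OF bounded_linear_minus[OF bounded_linear_ident]]
        differentiable_order_bilinear[OF bounded_bilinear_mult])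
qed simp

text \<open>Same self-reference as for the inverse: the derivative \<open>f' / (2 sqrt f)\<close>
  contains the root, already known to order \<open>n\<close>. Positivity keeps the root away from
  its singular point.\<close>

lemma differentiable_order_sqrt:
  fixes f :: "real \<Rightarrow> real"
  assumes "\<And>s. f s > 0"
  shows "differentiable_order n f \<Longrightarrow> differentiable_order n (\<lambda>s. sqrt (f s))"
proof (induction n)
  case (Suc n)
  have "(f has_real_derivative Dv f s) (at s)" for s
    using differentiable_order_has_vector_derivative[OF Suc.prems]
    by (simp add: has_real_derivative_iff_has_vector_derivative)
  then have deriv: "((\<lambda>s. sqrt (f s)) has_real_derivative inverse (sqrt (f s)) / 2 * Dv f s) (at s)" for s
    using DERIV_chain2[where f = sqrt and g = f, OF DERIV_real_sqrt[OF assms]] by blast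
  have "differentiable_order n (\<lambda>s. sqrt (f s))"
    using Suc differentiable_order_SucD by blast
  then have "differentiable_order n (\<lambda>s. inverse (sqrt (f s)))"
    using assms by (intro differentiable_order_inverse) (auto simp: less_imp_neq[symmetric])
  moreover have "differentiable_order n (Dv f)"
    using Suc.prems by simp
  ultimately show ?case
    by (intro differentiable_order_SucI[OF deriv[unfolded has_real_derivative_iff_has_vector_derivative
          divide_inverse]] differentiable_order_const
        differentiable_order_bilinear[OF bounded_bilinear_mult])
qed simp

lemma smooth_const: "smooth (\<lambda>s. c)"
  by (simp add: smooth_iff_differentiable_order differentiable_order_const)

lemma smooth_linear: "bounded_linear h \<Longrightarrow> smooth f \<Longrightarrow> smooth (\<lambda>s. h (f s))"
  by (simp add: smooth_iff_differentiable_order differentiable_order_linear)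

lemma smooth_add: "smooth f \<Longrightarrow> smooth g \<Longrightarrow> smooth (\<lambda>s. f s + g s)"
  by (simp add: smooth_iff_differentiable_order differentiable_order_add)

lemma smooth_minus: "smooth f \<Longrightarrow> smooth (\<lambda>s. - f s)"
  using smooth_linear[OF bounded_linear_minus[OF bounded_linear_ident]] .

lemma smooth_diff: "smooth f \<Longrightarrow> smooth g \<Longrightarrow> smooth (\<lambda>s. f s - g s)"
  using smooth_add[of f "\<lambda>s. - g s"] smooth_minus[of g] by simp

lemma smooth_bilinear:
  "bounded_bilinear h \<Longrightarrow> smooth f \<Longrightarrow> smooth g \<Longrightarrow> smooth (\<lambda>s. h (f s) (g s))"
  by (simp add: smooth_iff_differentiable_order differentiable_order_bilinear)

lemma smooth_inverse:
  fixes f :: "real \<Rightarrow> real"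
  shows "smooth f \<Longrightarrow> (\<And>s. f s \<noteq> 0) \<Longrightarrow> smooth (\<lambda>s. inverse (f s))"
  by (simp add: smooth_iff_differentiable_order differentiable_order_inverse)

lemma smooth_norm:
  fixes f :: "real \<Rightarrow> 'a::real_inner"
  assumes "smooth f" "\<And>s. f s \<noteq> 0"
  shows "smooth (\<lambda>s. norm (f s))"
  unfolding norm_eq_sqrt_inner
  using assms smooth_bilinear[OF bounded_bilinear_inner assms(1,1)]
  by (simp add: smooth_iff_differentiable_order differentiable_order_sqrt)

section \<open>Iterated derivatives of sums, linear images and translates\<close>

lemma nth_deriv_add:
  "smooth f \<Longrightarrow> smooth g \<Longrightarrow> nth_deriv k (\<lambda>s. f s + g s) s = nth_deriv k f s + nth_deriv k g s"
proof (induction k arbitrary: f g)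
  case (Suc k)
  have "Dv (\<lambda>s. f s + g s) = (\<lambda>s. Dv f s + Dv g s)"
    by (intro Dv_eqI has_vector_derivative_add smooth_has_vector_derivative Suc.prems)
  then show ?case
    using Suc by (simp add: nth_deriv_Suc' smooth_Dv)
qed simp

lemma nth_deriv_linear:
  assumes "bounded_linear h"
  shows "smooth f \<Longrightarrow> nth_deriv k (\<lambda>s. h (f s)) = (\<lambda>s. h (nth_deriv k f s))"
proof (induction k arbitrary: f)
  case (Suc k)
  have "Dv (\<lambda>s. h (f s)) = (\<lambda>s. h (Dv f s))"
    by (intro Dv_eqI bounded_linear.has_vector_derivative[OF assms] smooth_has_vector_derivative
        Suc.prems)
  then show ?case
    using Suc by (simp add: nth_deriv_Suc' smooth_Dv)
qed simp

lemma has_vector_derivative_translate: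
  "((\<lambda>s. f (s + a)) has_vector_derivative D) (at s) \<longleftrightarrow> (f has_vector_derivative D) (at (s + a))"
    (is "?l \<longleftrightarrow> ?r")
proof
  assume ?l
  have "((\<lambda>t. t - a) has_vector_derivative 1) (at (s + a))"
    by (auto intro!: derivative_eq_intros)
  from vector_diff_chain_at[OF this, of "\<lambda>s. f (s + a)" D] \<open>?l\<close> show ?r
    by (simp add: o_def)
next
  assume ?r
  have "((\<lambda>t. t + a) has_vector_derivative 1) (at s)"
    by (auto intro!: derivative_eq_intros)
  from vector_diff_chain_at[OF this, of f D] \<open>?r\<close> show ?l
    by (simp add: o_def)
qed

lemma nth_deriv_translate: "nth_deriv k (\<lambda>s. f (s + a)) s = nth_deriv k f (s + a)"
proof (induction k arbitrary: f)
  case (Suc k)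
  have "Dv (\<lambda>s. f (s + a)) = (\<lambda>s. Dv f (s + a))"
    by (simp add: vector_derivative_def has_vector_derivative_translate)
  then show ?case
    using Suc[of "Dv f"] by (simp add: nth_deriv_Suc')
qed simp

section \<open>Flat points\<close>

definition flat :: "(real \<Rightarrow> 'a::real_normed_vector) \<Rightarrow> real \<Rightarrow> bool" where
  "flat f p \<longleftrightarrow> (\<forall>k. nth_deriv k f p = 0)"

lemma flat_zero: "flat f p \<Longrightarrow> f p = 0"
  by (metis flat_def nth_deriv_0)

lemma flat_Dv: "flat f p \<Longrightarrow> flat (Dv f) p"
  by (metis flat_def nth_deriv_Suc')

lemma flat_add: "smooth f \<Longrightarrow> smooth g \<Longrightarrow> flat f p \<Longrightarrow> flat g p \<Longrightarrow> flat (\<lambda>s. f s + g s) p"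
  by (simp add: flat_def nth_deriv_add)

lemma flat_linear: "bounded_linear h \<Longrightarrow> smooth f \<Longrightarrow> flat f p \<Longrightarrow> flat (\<lambda>s. h (f s)) p"
  by (simp add: flat_def nth_deriv_linear linear_0 bounded_linear.linear)

text \<open>Flat functions form an ideal: both terms \<open>h f g'\<close> and \<open>h f' g\<close>
  of the product rule again have a flat second factor, so the induction on \<open>k\<close> runs
  over all pairs \<open>f\<close>, \<open>g\<close>. For analytic curves it transfers flatness from
  the torsion to a multiple of it by a smooth function.\<close>

lemma flat_bilinear:
  assumes h: "bounded_bilinear h" and "smooth f" "smooth g" "flat g p"
  shows "flat (\<lambda>s. h (f s) (g s)) p"
proof -
  have "nth_deriv k (\<lambda>s. h (f s) (g s)) p = 0" for k
    using assms(2-)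
  proof (induction k arbitrary: f g)
    case 0
    then show ?case by (simp add: flat_zero bounded_bilinear.zero_right[OF h])
  next
    case (Suc k)
    have "Dv (\<lambda>s. h (f s) (g s)) = (\<lambda>s. h (f s) (Dv g s) + h (Dv f s) (g s))"
      by (intro Dv_eqI bounded_bilinear.has_vector_derivative[OF h] smooth_has_vector_derivative
          Suc.prems)
    with Suc show ?case
      by (simp add: nth_deriv_Suc' nth_deriv_add smooth_bilinear[OF h] smooth_Dv flat_Dv)
  qed
  then show ?thesis by (simp add: flat_def)
qed

text \<open>Flatness passes to linear combinations, and \<open>f\<close> is half of
  \<open>(g + f) - (g - f)\<close>.\<close>

lemma flat_from_diff_add:
  fixes f g :: "real \<Rightarrow> real"
  assumes f: "smooth f" and g: "smooth g"
    and flat: "flat (\<lambda>s. g s - f s) p" "flat (\<lambda>s. g s + f s) p"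
  shows "flat f p"
proof -
  have sm: "smooth (\<lambda>s. g s - f s)" "smooth (\<lambda>s. g s + f s)"
    by (intro smooth_diff smooth_add f g)+
  have "flat (\<lambda>s. (g s + f s) + - (g s - f s)) p"
    using flat_add[OF sm(2) smooth_minus[OF sm(1)]] sm(1) flat
      flat_linear[OF bounded_linear_minus[OF bounded_linear_ident]] by blast
  moreover have "smooth (\<lambda>s. (g s + f s) + - (g s - f s))"
    by (intro smooth_add[OF sm(2) smooth_minus[OF sm(1)]])
  ultimately have "flat (\<lambda>s. (1/2) * ((g s + f s) + - (g s - f s))) p"
    using flat_linear[OF bounded_linear_mult_right] by blast
  then show ?thesis by simp
qed

lemma islimpt_zeros_zero:
  fixes f :: "real \<Rightarrow> real"
  assumes "smooth f" "p islimpt {s. f s = 0}"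
  shows "f p = 0"
proof -
  have "closed {s. f s = 0}"
    using smooth_isCont[OF assms(1)]
    by (intro closed_Collect_eq) (auto intro: continuous_at_imp_continuous_on)
  then show ?thesis
    using assms(2) closed_limpt by blast
qed

text \<open>The point \<open>p\<close> is itself a zero, by continuity, so Rolle applies between
  \<open>p\<close> and any nearby zero \<open>x\<close>. The zero of the derivative lies strictly
  between them, hence differs from \<open>p\<close> and is closer to it than
  \<open>x\<close>.\<close>

lemma islimpt_zeros_Dv:
  fixes f :: "real \<Rightarrow> real"
  assumes "smooth f" "p islimpt {s. f s = 0}"
  shows "p islimpt {s. Dv f s = 0}"
  unfolding islimpt_approachable
proof (intro allI impI)
  fix e :: real assume "e > 0"
  then obtain x where x: "f x = 0" "x \<noteq> p" "dist x p < e"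
    using assms(2) unfolding islimpt_approachable by blast
  have fp: "f p = 0"
    by (rule islimpt_zeros_zero[OF assms])
  define a b where "a = min x p" and "b = max x p"
  have ab: "a < b" "f a = f b"
    using x fp by (auto simp: a_def b_def min_def max_def)
  have "continuous_on {a..b} f"
    using smooth_isCont[OF assms(1)] by (auto intro: continuous_at_imp_continuous_on)
  moreover have "f differentiable at t" for t
    using assms(1) by (metis smooth_def nth_deriv_0)
  ultimately obtain z where z: "a < z" "z < b" "DERIV f z :> 0"
    using Rolle[OF ab] by blast
  have "Dv f z = 0"
    using z(3) DERIV_unique smooth_has_real_derivative[OF assms(1)] by blast
  moreover have "z \<noteq> p" "dist z p < e"
    using z x by (auto simp: a_def b_def dist_real_def min_def max_def split: if_splits)
  ultimately show "\<exists>x'\<in>{s. Dv f s = 0}. x' \<noteq> p \<and> dist x' p < e"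
    by blast
qed

lemma islimpt_zeros_flat:
  fixes f :: "real \<Rightarrow> real"
  assumes "smooth f" "p islimpt {s. f s = 0}"
  shows "flat f p"
proof -
  have "nth_deriv k f p = 0" for k
    using assms
  proof (induction k arbitrary: f)
    case 0
    then show ?case by (simp add: islimpt_zeros_zero)
  next
    case (Suc k)
    then show ?case by (simp add: nth_deriv_Suc' smooth_Dv islimpt_zeros_Dv)
  qed
  then show ?thesis by (simp add: flat_def)
qed

lemma eventually_zero_flat:
  fixes f :: "real \<Rightarrow> real"
  assumes "smooth f" "eventually (\<lambda>s. f s = 0) (nhds p)"
  shows "flat f p"
proof -
  have "p islimpt {s. f s = 0}"
  proof -
    obtain T where T: "open T" "p \<in> T" "\<forall>s\<in>T. f s = 0"
      using assms(2) eventually_nhds by blast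
    have "p islimpt T"
      using T by (simp add: interior_limit_point interior_open)
    then show ?thesis
      by (rule islimpt_subset) (use T in auto)
  qed
  then show ?thesis
    using assms(1) islimpt_zeros_flat by blast
qed

lemma closed_flat_set:
  fixes f :: "real \<Rightarrow> 'a::real_normed_vector"
  assumes "smooth f"
  shows "closed {s. flat f s}"
proof -
  have "closed {s. nth_deriv k f s = 0}" for k
    using smooth_isCont[OF smooth_nth_deriv[OF assms]]
    by (intro closed_Collect_eq) (auto intro: continuous_at_imp_continuous_on)
  then show ?thesis
    unfolding flat_def by (intro closed_Collect_all) auto
qed

lemma eventually_eq_or_eq_minus:
  fixes f g :: "real \<Rightarrow> real"
  assumes f: "smooth f" and g: "smooth g" and abs: "\<And>s. \<bar>g s\<bar> = \<bar>f s\<bar>" and "\<not> flat f p"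
  shows "eventually (\<lambda>s. g s = f s) (nhds p) \<or> eventually (\<lambda>s. g s = - f s) (nhds p)"
proof -
  let ?a = "\<lambda>s. g s - f s" and ?b = "\<lambda>s. g s + f s"
  have sm: "smooth ?a" "smooth ?b"
    by (intro smooth_diff smooth_add f g)+
  have prod: "?a s = 0 \<or> ?b s = 0" for s
    using abs[of s] by (auto simp: abs_if split: if_splits)
  \<comment> \<open>Stated for a generic pair, to be used in both roles: if the zeros of
    \<open>v\<close> do not accumulate at \<open>p\<close>, then \<open>u\<close> vanishes on a
    punctured neighbourhood, and at \<open>p\<close> itself by continuity.\<close>
  have *: "eventually (\<lambda>s. u s = 0) (nhds p)"
    if "smooth u" "\<not> p islimpt {s. v s = 0}" "\<And>s. v s = 0 \<or> u s = 0" for u v :: "real \<Rightarrow> real"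
  proof -
    have "eventually (\<lambda>s. v s \<noteq> 0) (at p)"
      using that(2) by (simp add: islimpt_iff_eventually)
    then have ev: "eventually (\<lambda>s. u s = 0) (at p)"
      by eventually_elim (use that(3) in auto)
    have "(u \<longlongrightarrow> 0) (at p)"
      using ev by (rule tendsto_eventually)
    moreover have "(u \<longlongrightarrow> u p) (at p)"
      using smooth_isCont[OF that(1)] isCont_def by blast
    ultimately have "u p = 0"
      using tendsto_unique trivial_limit_at by blast
    with ev show ?thesis
      by (simp add: eventually_nhds_conv_at)
  qed
  have "\<not> (flat ?a p \<and> flat ?b p)"
    using flat_from_diff_add[OF f g] assms(4) by blast
  then consider "\<not> p islimpt {s. ?a s = 0}" | "\<not> p islimpt {s. ?b s = 0}"
    using islimpt_zeros_flat sm by blast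
  then show ?thesis
  proof cases
    case 1
    then have "eventually (\<lambda>s. ?b s = 0) (nhds p)"
      using *[of ?b ?a] sm prod by blast
    then show ?thesis
      by (intro disjI2) (auto elim: eventually_mono)
  next
    case 2
    then have "eventually (\<lambda>s. ?a s = 0) (nhds p)"
      using *[of ?a ?b] sm prod by blast
    then show ?thesis
      by (intro disjI1) (auto elim: eventually_mono)
  qed
qed

text \<open>At a point of \<open>Z\<close> the new function is \<open>o(\<bar>s - p\<bar>)\<close> because \<open>f\<close> is, whatever the signs.\<close>

lemma has_vector_derivative_signs:
  fixes f E :: "real \<Rightarrow> real"
  assumes "smooth f" "closed Z" "\<And>s. s \<in> Z \<Longrightarrow> flat f s" "\<And>s. \<bar>E s\<bar> \<le> 1"
    and E: "\<And>s. s \<notin> Z \<Longrightarrow> eventually (\<lambda>t. E t = E s) (nhds s)"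
  shows "((\<lambda>s. if s \<in> Z then 0 else E s * f s) has_vector_derivative
      (if p \<in> Z then 0 else E p * Dv f p)) (at p)"
    (is "(?g has_vector_derivative _) _")
proof (cases "p \<in> Z")
  case True
  have f: "f p = 0" "Dv f p = 0"
    using assms(3)[OF True] flat_zero flat_Dv by blast+
  have "((\<lambda>y. (f y - f p) / (y - p)) \<longlongrightarrow> 0) (at p)"
    using smooth_has_real_derivative[OF assms(1), of p] f by (simp add: DERIV_def has_field_derivative_iff)
  then have "((\<lambda>y. f y / (y - p)) \<longlongrightarrow> 0) (at p)"
    using f by simp
  then have lim: "((\<lambda>y. \<bar>f y / (y - p)\<bar>) \<longlongrightarrow> 0) (at p)"
    by (rule tendsto_rabs_zero)
  have bound: "\<bar>?g y / (y - p)\<bar> \<le> \<bar>f y / (y - p)\<bar>" for y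
    using assms(4)[of y] by (auto simp: abs_mult abs_divide intro!: divide_right_mono mult_left_le_one_le)
  have "((\<lambda>y. (?g y - ?g p) / (y - p)) \<longlongrightarrow> 0) (at p)"
    using True bound by (intro Lim_null_comparison[OF _ lim]) simp
  then have "(?g has_real_derivative 0) (at p)"
    by (simp add: has_field_derivative_iff)
  then show ?thesis
    using True by (simp add: has_real_derivative_iff_has_vector_derivative)
next
  case False
  have "eventually (\<lambda>t. t \<in> - Z) (nhds p)"
    using assms(2) False by (intro eventually_nhds_in_open) auto
  with E[OF False] have ev: "eventually (\<lambda>t. E p * f t = ?g t) (nhds p)"
    by eventually_elim auto
  have "((\<lambda>t. E p * f t) has_real_derivative E p * Dv f p) (at p)"
    by (intro DERIV_cmult smooth_has_real_derivative assms)
  then have "(?g has_real_derivative E p * Dv f p) (at p)"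
    using DERIV_cong_ev[OF refl ev refl] by blast
  then show ?thesis
    using False by (simp add: has_real_derivative_iff_has_vector_derivative)
qed

text \<open>The derivative of the modified function is the same modification of \<open>Dv f\<close>,
  which is again smooth and flat on \<open>Z\<close>. The signs \<open>E\<close> and the set
  \<open>Z\<close> never change, so the induction on the order closes up.\<close>

lemma smooth_signs:
  fixes f E :: "real \<Rightarrow> real"
  assumes "smooth f" "closed Z" "\<And>s. s \<in> Z \<Longrightarrow> flat f s" "\<And>s. \<bar>E s\<bar> \<le> 1"
    and E: "\<And>s. s \<notin> Z \<Longrightarrow> eventually (\<lambda>t. E t = E s) (nhds s)"
  shows "smooth (\<lambda>s. if s \<in> Z then 0 else E s * f s)"
proof -
  have "differentiable_order n (\<lambda>s. if s \<in> Z then 0 else E s * f s)" for n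
    using assms(1,3)
  proof (induction n arbitrary: f)
    case (Suc n)
    show ?case
      by (rule differentiable_order_SucI[OF
            has_vector_derivative_signs[OF Suc.prems(1) assms(2) Suc.prems(2) assms(4,5)]
            Suc.IH[OF smooth_Dv[OF Suc.prems(1)] flat_Dv[OF Suc.prems(2)]]])
  qed simp
  then show ?thesis
    by (simp add: smooth_iff_differentiable_order)
qed

section \<open>The circle\<close>

lemma periodic_int:
  assumes "periodic L f"
  shows "f (s + of_int n * L) = f s"
proof (induction n arbitrary: s rule: int_induct[where k = 0])
  case (step1 i)
  then show ?case
    using assms[unfolded periodic_def, rule_format, of "s + of_int i * L"]
    by (simp add: algebra_simps)
next
  case (step2 i)
  then show ?case
    using assms[unfolded periodic_def, rule_format, of "s + of_int (i - 1) * L"]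
    by (simp add: algebra_simps)
qed simp

lemma periodic_nth_deriv: "periodic L f \<Longrightarrow> periodic L (nth_deriv k f)"
  using nth_deriv_translate[of k f L] by (simp add: periodic_def)

lemma periodic_Dv: "periodic L f \<Longrightarrow> periodic L (Dv f)"
  using periodic_nth_deriv[of L f 1] by (simp add: nth_deriv_Suc)

lemma periodic_flat: "periodic L f \<Longrightarrow> periodic L (flat f)"
  using periodic_nth_deriv[of L f] by (simp add: periodic_def flat_def)

lemma norm_circ [simp]: "cmod (circ L s) = 1"
  by (simp add: circ_def)

lemma circ_in_S1: "circ L s \<in> S1"
  by simp

lemma continuous_circ: "continuous_on A (circ L)"
  unfolding circ_def divide_inverse by (intro continuous_intros)

context
  fixes L :: real
  assumes L: "L > 0"
begin

lemma circ_eq_iff: "circ L s = circ L t \<longleftrightarrow> (\<exists>n::int. s = t + of_int n * L)"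
proof -
  have "circ L s = circ L t \<longleftrightarrow> (\<exists>n::int. 2 * pi * s / L = 2 * pi * t / L + 2 * pi * n)"
    unfolding circ_def complex_eq_iff cis.simps using sin_cos_eq_iff by blast
  also have "\<dots> \<longleftrightarrow> (\<exists>n::int. s = t + of_int n * L)"
  proof (intro ex_cong1)
    fix n :: int
    have "2 * pi * s / L = 2 * pi * t / L + 2 * pi * n \<longleftrightarrow>
        (2 * pi / L) * s = (2 * pi / L) * (t + of_int n * L)"
      using L by (simp add: field_simps)
    then show "2 * pi * s / L = 2 * pi * t / L + 2 * pi * n \<longleftrightarrow> s = t + of_int n * L"
      using L by simp
  qed
  finally show ?thesis .
qed

lemma periodic_circ: "periodic L f \<Longrightarrow> circ L s = circ L t \<Longrightarrow> f s = f t"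
  using periodic_int circ_eq_iff by metis

lemma periodic_circ_comp: "periodic L (\<lambda>s. h (circ L s))"
proof -
  have "circ L (s + L) = circ L s" for s
    unfolding circ_eq_iff by (intro exI[of _ 1]) simp
  then show ?thesis by (simp add: periodic_def)
qed

text \<open>The period \<open>[a, a + L)\<close> is free to choose so that a preimage can be located
  relative to a given arc. An argument of \<open>z\<close> gives one preimage; a multiple of
  \<open>L\<close> moves it into the period.\<close>

lemma circ_surj:
  assumes "z \<in> S1"
  obtains s where "a \<le> s" "s < a + L" "circ L s = z"
proof -
  define t where "t = Arg z * L / (2 * pi)"
  have "z \<noteq> 0" "sgn z = z"
    using assms by (auto simp: sgn_div_norm)
  then have t: "circ L t = z"
    using L cis_Arg[of z] by (simp add: circ_def t_def)
  define n where "n = \<lfloor>(t - a) / L\<rfloor>"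
  have "of_int n \<le> (t - a) / L" "(t - a) / L < of_int n + 1"
    unfolding n_def by linarith+
  then have "of_int n * L \<le> t - a" "t - a < (of_int n + 1) * L"
    using L by (simp_all add: pos_le_divide_eq pos_divide_less_eq)
  moreover have "circ L (t - of_int n * L) = circ L t"
    unfolding circ_eq_iff by (intro exI[of _ "- n"]) simp
  ultimately show ?thesis
    using t by (intro that[of "t - of_int n * L"]) (auto simp: algebra_simps)
qed

text \<open>The complement of the open arc is the image of the closed rest of one period. That image
  is compact, hence closed, so no local inverse of the covering map is involved. For
  \<open>2 * e > L\<close> the rest is empty and the arc is the whole circle.\<close>

lemma circ_open_interval: "openin (top_of_set S1) (circ L ` {s - e<..<s + e})"
proof -
  have "circ L ` {s - e<..<s + e} = S1 - circ L ` {s + e..s + L - e}"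
  proof (intro set_eqI iffI)
    fix z assume "z \<in> circ L ` {s - e<..<s + e}"
    then obtain t where t: "s - e < t" "t < s + e" "z = circ L t"
      by auto
    have "circ L u \<noteq> circ L t" if u: "s + e \<le> u" "u \<le> s + L - e" for u
    proof
      assume "circ L u = circ L t"
      then obtain n :: int where n: "u = t + of_int n * L"
        unfolding circ_eq_iff by blast
      \<comment> \<open>Two points \<open>t < u\<close> less than one period apart cannot differ by
        an integral multiple of \<open>L\<close>.\<close>
      with t u have "0 < of_int n * L" "of_int n * L < L"
        by linarith+
      then have "0 < n" "n < 1"
        using L mult_less_cancel_right_pos[OF L, of "of_int n" 1] by (simp_all add: zero_less_mult_iff)
      then show False by simp
    qed
    with t circ_in_S1 show "z \<in> S1 - circ L ` {s + e..s + L - e}"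
      by fastforce
  next
    fix z assume z: "z \<in> S1 - circ L ` {s + e..s + L - e}"
    then obtain t where t: "s \<le> t" "t < s + L" "circ L t = z"
      using circ_surj[of z s] by blast
    have "circ L (t - L) = circ L t"
      unfolding circ_eq_iff by (intro exI[of _ "-1"]) simp
    moreover have "\<not> (s + e \<le> t \<and> t \<le> s + L - e)"
      using z t(3) by auto
    then consider "t \<in> {s - e<..<s + e}" | "t - L \<in> {s - e<..<s + e}"
      using t by force
    ultimately show "z \<in> circ L ` {s - e<..<s + e}"
      using t(3) by cases (metis imageI)+
  qed
  moreover have "closed (circ L ` {s + e..s + L - e})"
    by (intro compact_imp_closed compact_continuous_image continuous_circ) simp
  ultimately show ?thesis
    by (metis Diff_eq openin_open open_Compl)
qed

lemma circ_open_map: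
  assumes "open T"
  shows "openin (top_of_set S1) (circ L ` T)"
  unfolding openin_subopen[of _ "circ L ` T"]
proof
  fix z assume "z \<in> circ L ` T"
  then obtain s where s: "s \<in> T" "z = circ L s"
    by blast
  then obtain e where e: "e > 0" "ball s e \<subseteq> T"
    using assms open_contains_ball by blast
  then have "{s - e<..<s + e} \<subseteq> T"
    by (simp add: ball_eq_greaterThanLessThan)
  with s e circ_open_interval[of s e]
  show "\<exists>T'. openin (top_of_set S1) T' \<and> z \<in> T' \<and> T' \<subseteq> circ L ` T"
    by (intro exI[of _ "circ L ` {s - e<..<s + e}"]) auto
qed

lemma circ_in_Z_inf_iff:
  assumes "periodic L f"
  shows "circ L s \<in> Z_inf L f \<longleftrightarrow> flat f s"
proof
  assume "circ L s \<in> Z_inf L f"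
  then obtain t where "circ L s = circ L t" "flat f t"
    by (auto simp: Z_inf_def flat_def)
  then show "flat f s"
    using periodic_circ[OF periodic_flat[OF assms]] by metis
qed (auto simp: Z_inf_def flat_def)

lemma S1_minus_Z_inf:
  assumes "periodic L f"
  shows "S1 - Z_inf L f = circ L ` {s. \<not> flat f s}"
proof (intro set_eqI iffI)
  fix z assume z: "z \<in> S1 - Z_inf L f"
  then obtain s where "circ L s = z"
    using circ_surj by blast
  with z assms show "z \<in> circ L ` {s. \<not> flat f s}"
    by (auto simp: circ_in_Z_inf_iff)
qed (use assms circ_in_S1 in \<open>auto simp: circ_in_Z_inf_iff\<close>)

lemma openin_S1_minus_Z_inf:
  assumes "smooth f" "periodic L f"
  shows "openin (top_of_set S1) (S1 - Z_inf L f)"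
  unfolding S1_minus_Z_inf[OF assms(2)]
  using closed_flat_set[OF assms(1)] by (intro circ_open_map) (simp add: closed_def Compl_eq)

section \<open>Signed lifts\<close>

lemma sign_functions_eventually:
  assumes f: "smooth f" "periodic L f" and \<epsilon>: "\<epsilon> \<in> sign_functions (S1 - Z_inf L f)"
    and s: "\<not> flat f s"
  shows "eventually (\<lambda>t. \<epsilon> (circ L t) = \<epsilon> (circ L s)) (nhds s)"
proof -
  let ?U = "S1 - Z_inf L f"
  have "circ L s \<in> ?U"
    using s f by (simp add: circ_in_Z_inf_iff circ_in_S1)
  moreover have "locally (\<lambda>V. \<epsilon> constant_on V) ?U"
    using \<epsilon> by (simp add: sign_functions_def)
  ultimately obtain u v where uv: "openin (top_of_set ?U) u" "\<epsilon> constant_on v"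
      "circ L s \<in> u" "u \<subseteq> v"
    by (metis locally_def openin_subtopology_self)
  then obtain W where W: "open W" "u = ?U \<inter> W"
    by (auto simp: openin_open)
  have "open (circ L -` W \<inter> {t. \<not> flat f t})"
    using W closed_flat_set[OF f(1)] continuous_circ[of UNIV L]
    by (intro open_Int open_vimage) (simp_all add: closed_def Compl_eq)
  then have "eventually (\<lambda>t. t \<in> circ L -` W \<inter> {t. \<not> flat f t}) (nhds s)"
    using uv W s by (intro eventually_nhds_in_open) auto
  then show ?thesis
  proof eventually_elim
    case (elim t)
    then have "circ L t \<in> u"
      using W f by (auto simp: circ_in_Z_inf_iff circ_in_S1)
    then show ?case
      using uv unfolding constant_on_def by (metis subsetD)
  qed
qed

text \<open>Periodicity lets \<open>E\<close> descend to the circle by evaluating it at an arbitrary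
  preimage. Local constancy survives because \<open>circ L\<close> is open: the image of a
  neighbourhood on which \<open>E\<close> is constant is a neighbourhood in the circle.\<close>

lemma sign_functions_obtain:
  assumes f: "smooth f" "periodic L f"
    and E: "periodic L E" "\<And>s. E s \<in> {1, -1}"
      "\<And>s. \<not> flat f s \<Longrightarrow> eventually (\<lambda>t. E t = E s) (nhds s)"
  obtains \<epsilon> where "\<epsilon> \<in> sign_functions (S1 - Z_inf L f)"
    "\<And>s. \<not> flat f s \<Longrightarrow> \<epsilon> (circ L s) = E s"
proof
  let ?U = "S1 - Z_inf L f"
  define \<epsilon> where "\<epsilon> = restrict (\<lambda>z. E (SOME s. circ L s = z)) ?U"
  have "circ L (SOME s'. circ L s' = circ L s) = circ L s" for s
    by (rule someI) simp
  then have "E (SOME s'. circ L s' = circ L s) = E s" for s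
    using periodic_circ[OF E(1)] by blast
  then show eq: "\<epsilon> (circ L s) = E s" if "\<not> flat f s" for s
    using that f by (simp add: \<epsilon>_def circ_in_S1 circ_in_Z_inf_iff)
  have "locally (\<lambda>V. \<epsilon> constant_on V) ?U"
  proof (rule locallyI)
    fix w z assume w: "openin (top_of_set ?U) w" "z \<in> w"
    then have "z \<in> ?U"
      using openin_imp_subset by blast
    then obtain s where s: "z = circ L s" "\<not> flat f s"
      using S1_minus_Z_inf[OF f(2)] by auto
    obtain T where T: "open T" "s \<in> T" "\<And>t. t \<in> T \<Longrightarrow> E t = E s"
      using E(3)[OF s(2)] unfolding eventually_nhds by blast
    define T' where "T' = T \<inter> {t. \<not> flat f t}"
    have "open T'"
      using T(1) closed_flat_set[OF f(1)] unfolding T'_def closed_def Compl_eq by auto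
    then have "openin (top_of_set S1) (circ L ` T')"
      by (rule circ_open_map)
    then have "openin (top_of_set ?U) (circ L ` T')"
      by (rule openin_subset_trans) (auto simp: S1_minus_Z_inf[OF f(2)] T'_def)
    then have 1: "openin (top_of_set ?U) (circ L ` T' \<inter> w)"
      using w by blast
    have 2: "\<epsilon> constant_on circ L ` T' \<inter> w"
      using T(3) eq by (auto simp: constant_on_def T'_def)
    have 3: "z \<in> circ L ` T' \<inter> w"
      using s T w by (auto simp: T'_def)
    show "\<exists>u v. openin (top_of_set ?U) u \<and> \<epsilon> constant_on v \<and> z \<in> u \<and> u \<subseteq> v \<and> v \<subseteq> w"
      using 1 2 3 by blast
  qed
  moreover have "\<epsilon> \<in> ?U \<rightarrow>\<^sub>E {1, -1}"
    using E(2) by (auto simp: \<epsilon>_def)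
  ultimately show "\<epsilon> \<in> sign_functions ?U"
    by (simp add: sign_functions_def)
qed

lemma apply_signs_in_signed_lifts:
  assumes f: "smooth f" "periodic L f" and \<epsilon>: "\<epsilon> \<in> sign_functions (S1 - Z_inf L f)"
  shows "apply_signs L f \<epsilon> \<in> signed_lifts L f"
proof -
  \<comment> \<open>Over flat points \<open>\<epsilon>\<close> has the value
    \<open>undefined\<close>; replacing it by 1 there provides the bound on the signs that
    \<open>smooth_signs\<close> demands at every point.\<close>
  let ?E = "\<lambda>s. if flat f s then 1 else \<epsilon> (circ L s)"
  have val: "\<epsilon> (circ L s) \<in> {1, -1}" if "\<not> flat f s" for s
    using \<epsilon> that f PiE_mem[of \<epsilon> _ _ "circ L s"]
    by (auto simp: sign_functions_def circ_in_Z_inf_iff)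
  have eq: "apply_signs L f \<epsilon> = (\<lambda>s. if s \<in> {s. flat f s} then 0 else ?E s * f s)"
    using f by (auto simp: apply_signs_def circ_in_Z_inf_iff)
  have "smooth (apply_signs L f \<epsilon>)"
    unfolding eq
  proof (rule smooth_signs)
    show "\<bar>?E s\<bar> \<le> 1" for s
      using val[of s] by auto
    fix s assume s: "s \<notin> {s. flat f s}"
    have "eventually (\<lambda>t. t \<in> - {s. flat f s}) (nhds s)"
      using closed_flat_set[OF f(1)] s by (intro eventually_nhds_in_open) auto
    with sign_functions_eventually[OF f \<epsilon>, of s] s
    show "eventually (\<lambda>t. ?E t = ?E s) (nhds s)"
      by (auto elim: eventually_elim2)
  qed (use f closed_flat_set in auto)
  moreover have "periodic L (apply_signs L f \<epsilon>)"
    using f(2) periodic_circ_comp[of "\<lambda>z. z \<in> Z_inf L f"] periodic_circ_comp[of \<epsilon>]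
    by (simp add: apply_signs_def periodic_def)
  moreover have "\<bar>apply_signs L f \<epsilon> s\<bar> = \<bar>f s\<bar>" for s
    using val[of s] flat_zero[of f s] by (auto simp: eq)
  ultimately show ?thesis
    by (simp add: signed_lifts_def)
qed

text \<open>A value of the lift at \<open>s\<close> alone may say nothing, as \<open>f s\<close> can
  be 0. But near \<open>s\<close> both sign functions are constant, so
  \<open>(\<epsilon> z - \<delta> z) * f\<close> vanishes on a neighbourhood, and \<open>f\<close>
  does not because \<open>s\<close> is not flat.\<close>

lemma inj_apply_signs:
  assumes f: "smooth f" "periodic L f"
  shows "inj_on (apply_signs L f) (sign_functions (S1 - Z_inf L f))"
proof (rule inj_onI)
  let ?U = "S1 - Z_inf L f"
  fix \<epsilon> \<delta> assume \<epsilon>: "\<epsilon> \<in> sign_functions ?U" and \<delta>: "\<delta> \<in> sign_functions ?U"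
    and eq: "apply_signs L f \<epsilon> = apply_signs L f \<delta>"
  have "\<epsilon> z = \<delta> z" if "z \<in> ?U" for z
  proof -
    obtain s where s: "z = circ L s" "\<not> flat f s"
      using \<open>z \<in> ?U\<close> unfolding S1_minus_Z_inf[OF f(2)] by blast
    have "eventually (\<lambda>t. \<not> flat f t) (nhds s)"
      using closed_flat_set[OF f(1)] s(2) eventually_nhds_in_open[of "- {t. flat f t}" s] by auto
    then have "eventually (\<lambda>t. (\<epsilon> z - \<delta> z) * f t = 0) (nhds s)"
      using sign_functions_eventually[OF f \<epsilon> s(2)] sign_functions_eventually[OF f \<delta> s(2)]
    proof eventually_elim
      case (elim t)
      with fun_cong[OF eq, of t] s f show ?case
        by (simp add: apply_signs_def circ_in_Z_inf_iff algebra_simps)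
    qed
    moreover have "\<not> eventually (\<lambda>t. f t = 0) (nhds s)"
      using s(2) eventually_zero_flat[OF f(1)] by blast
    ultimately show ?thesis by auto
  qed
  with \<epsilon> \<delta> show "\<epsilon> = \<delta>"
    unfolding sign_functions_def by (blast intro: PiE_ext)
qed

lemma signed_lifts_subset:
  assumes f: "smooth f" "periodic L f"
  shows "signed_lifts L f \<subseteq> apply_signs L f ` sign_functions (S1 - Z_inf L f)"
proof
  fix g assume "g \<in> signed_lifts L f"
  then have g: "smooth g" "periodic L g" and abs: "\<And>s. \<bar>g s\<bar> = \<bar>f s\<bar>"
    by (auto simp: signed_lifts_def)
  \<comment> \<open>This criterion makes sense also at zeros of \<open>f\<close> and is visibly
    periodic. At a non-flat point exactly one of \<open>g = f\<close> and \<open>g = -f\<close>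
    holds nearby, and it detects which.\<close>
  define E :: "real \<Rightarrow> real" where "E s = (if flat (\<lambda>s. g s - f s) s then 1 else -1)" for s
  have E1: "E s = 1" if "eventually (\<lambda>t. g t = f t) (nhds s)" for s
    using that eventually_zero_flat[OF smooth_diff[OF g(1) f(1)]] by (simp add: E_def)
  have E2: "E s = -1" if "eventually (\<lambda>t. g t = - f t) (nhds s)" "\<not> flat f s" for s
  proof -
    have "eventually (\<lambda>t. g t + f t = 0) (nhds s)"
      using that(1) by eventually_elim simp
    then have "flat (\<lambda>t. g t + f t) s"
      by (intro eventually_zero_flat smooth_add g f)
    then have "\<not> flat (\<lambda>t. g t - f t) s"
      using that(2) flat_from_diff_add[OF f(1) g(1)] by blast
    then show ?thesis by (simp add: E_def)
  qed
  have E3: "eventually (\<lambda>t. E t = E s) (nhds s) \<and> g s = E s * f s" if s: "\<not> flat f s" for s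
    using eventually_eq_or_eq_minus[OF f(1) g(1) abs s]
  proof
    assume a: "eventually (\<lambda>t. g t = f t) (nhds s)"
    \<comment> \<open>Equality near \<open>s\<close> is also equality near each point close to
      \<open>s\<close>, so the germ criterion gives the same sign at all of them.\<close>
    then have "eventually (\<lambda>t. eventually (\<lambda>t. g t = f t) (nhds t)) (nhds s)"
      by (simp add: eventually_eventually)
    then have "eventually (\<lambda>t. E t = E s) (nhds s)"
      by eventually_elim (simp add: E1 a)
    with E1[OF a] a show ?thesis
      by (auto dest: eventually_nhds_x_imp_x)
  next
    assume a: "eventually (\<lambda>t. g t = - f t) (nhds s)"
    then have b: "eventually (\<lambda>t. eventually (\<lambda>t. g t = - f t) (nhds t)) (nhds s)"
      by (simp add: eventually_eventually)
    \<comment> \<open>The negative case must keep away from flat points of \<open>f\<close>: where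
      \<open>g = -f\<close> nearby, \<open>g - f = -2f\<close> is flat at such a point and
      \<open>E\<close> would be 1 there.\<close>
    have "eventually (\<lambda>t. t \<in> - {t. flat f t}) (nhds s)"
      using closed_flat_set[OF f(1)] s by (intro eventually_nhds_in_open) auto
    with b have "eventually (\<lambda>t. E t = E s) (nhds s)"
      by eventually_elim (simp add: E2 a s)
    with E2[OF a s] a show ?thesis
      by (auto dest: eventually_nhds_x_imp_x)
  qed
  have "periodic L (\<lambda>s. g s - f s)"
    using g(2) f(2) by (simp add: periodic_def)
  from periodic_flat[OF this] have "periodic L E"
    by (simp add: periodic_def E_def)
  moreover have "E s \<in> {1, -1}" for s
    by (simp add: E_def)
  ultimately obtain \<epsilon> where \<epsilon>: "\<epsilon> \<in> sign_functions (S1 - Z_inf L f)"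
    "\<And>s. \<not> flat f s \<Longrightarrow> \<epsilon> (circ L s) = E s"
    using sign_functions_obtain[OF f, of E] E3 by blast
  have "g s = apply_signs L f \<epsilon> s" for s
    using \<epsilon>(2)[of s] E3[of s] flat_zero[of f s] abs[of s] f
    by (auto simp: apply_signs_def circ_in_Z_inf_iff)
  with \<epsilon>(1) show "g \<in> apply_signs L f ` sign_functions (S1 - Z_inf L f)"
    by blast
qed

lemma bij_betw_apply_signs:
  assumes "smooth f" "periodic L f"
  shows "bij_betw (apply_signs L f) (sign_functions (S1 - Z_inf L f)) (signed_lifts L f)"
  unfolding bij_betw_def
  using inj_apply_signs[OF assms] signed_lifts_subset[OF assms] apply_signs_in_signed_lifts[OF assms]
  by blast

end

section \<open>Counting sign functions by components\<close>

lemma sign_functions_constant_on: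
  assumes "\<epsilon> \<in> sign_functions U" "connected C" "C \<subseteq> U"
  shows "\<epsilon> constant_on C"
proof (rule locally_constant_imp_constant[OF assms(2)])
  fix a assume "a \<in> C"
  with assms(3) have "a \<in> U"
    by blast
  moreover have "locally (\<lambda>V. \<epsilon> constant_on V) U"
    using assms(1) by (simp add: sign_functions_def)
  ultimately obtain u v where uv: "openin (top_of_set U) u" "\<epsilon> constant_on v" "a \<in> u" "u \<subseteq> v"
    by (metis locally_def openin_subtopology_self)
  then obtain W where "open W" "u = U \<inter> W"
    by (auto simp: openin_open)
  then have "C \<inter> u = C \<inter> W"
    using assms(3) by blast
  then have "openin (top_of_set C) (C \<inter> u)"
    using \<open>open W\<close> by (simp add: openin_open_Int)
  moreover have "\<forall>x\<in>C \<inter> u. \<epsilon> x = \<epsilon> a"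
    using uv unfolding constant_on_def by (metis IntE subsetD)
  ultimately show "\<exists>T. openin (top_of_set C) T \<and> a \<in> T \<and> (\<forall>x\<in>T. \<epsilon> x = \<epsilon> a)"
    using uv \<open>a \<in> C\<close> by blast
qed

text \<open>The choice of sign is encoded in \<open>bool\<close> because \<open>ctwo\<close> is the
  cardinal of that type, and \<open>ctwo ^c |components U|\<close> is by definition the cardinal of
  \<open>Func (components U) UNIV\<close>. The restriction to \<open>U\<close> matches the
  extensionality built into \<open>sign_functions\<close>.\<close>

definition signs_of_components :: "complex set \<Rightarrow> (complex set \<Rightarrow> bool) \<Rightarrow> complex \<Rightarrow> real" where
  "signs_of_components U h =
     restrict (\<lambda>z. if h (connected_component_set U z) then 1 else -1) U"

lemma signs_of_components_in_sign_functions: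
  assumes "locally connected U"
  shows "signs_of_components U h \<in> sign_functions U"
proof -
  have "locally (\<lambda>V. signs_of_components U h constant_on V) U"
  proof (rule locallyI)
    fix w z assume w: "openin (top_of_set U) w" "z \<in> w"
    then have z: "z \<in> U"
      using openin_imp_subset by blast
    let ?C = "connected_component_set U z"
    have 1: "openin (top_of_set U) (?C \<inter> w)"
      using openin_connected_component_locally_connected[OF assms] w by blast
    have "connected_component_set U x = ?C \<and> x \<in> U" if "x \<in> ?C" for x
      using that connected_component_eq connected_component_subset by blast
    then have 2: "signs_of_components U h constant_on ?C \<inter> w"
      by (auto simp: constant_on_def signs_of_components_def)
    have 3: "z \<in> ?C \<inter> w"
      using w z by simp
    show "\<exists>u v. openin (top_of_set U) u \<and> signs_of_components U h constant_on v \<and> z \<in> u \<and>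
        u \<subseteq> v \<and> v \<subseteq> w"
      using 1 2 3 by blast
  qed
  then show ?thesis
    by (auto simp: sign_functions_def signs_of_components_def)
qed

text \<open>Connectedness of a component forces a locally constant sign to be constant on it; local
  connectedness of \<open>U\<close> makes components open, so every choice of signs is locally
  constant. Hence sign functions correspond to Boolean functions on the set of components.\<close>

lemma card_sign_functions:
  assumes "locally connected U"
  shows "|sign_functions U| =o ctwo ^c |components U|"
proof -
  have "bij_betw (signs_of_components U) (Func (components U) UNIV) (sign_functions U)"
    unfolding bij_betw_def
  proof
    show "inj_on (signs_of_components U) (Func (components U) UNIV)"
    proof (rule inj_onI)
      fix h k :: "complex set \<Rightarrow> bool"
      assume h: "h \<in> Func (components U) UNIV" and k: "k \<in> Func (components U) UNIV"
        and eq: "signs_of_components U h = signs_of_components U k"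
      show "h = k"
      proof
        fix C
        show "h C = k C"
        proof (cases "C \<in> components U")
          case True
          then obtain z where "z \<in> U" "C = connected_component_set U z"
            by (auto simp: components_def)
          with fun_cong[OF eq, of z] show ?thesis
            by (auto simp: signs_of_components_def split: if_splits)
        qed (use h k in \<open>simp add: Func_def\<close>)
      qed
    qed
    have "\<epsilon> \<in> signs_of_components U ` Func (components U) UNIV" if \<epsilon>: "\<epsilon> \<in> sign_functions U" for \<epsilon>
    proof
      \<comment> \<open>Elements of \<open>Func\<close> must be \<open>undefined\<close> off their
        domain. On a component the sign is constant, so existence of one point with sign 1 decides
        it.\<close>
      define h where "h C = (if C \<in> components U then \<exists>z\<in>C. \<epsilon> z = 1 else undefined)" for C
      show "h \<in> Func (components U) UNIV"
        by (simp add: Func_def h_def)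
      show "\<epsilon> = signs_of_components U h"
      proof
        fix z
        show "\<epsilon> z = signs_of_components U h z"
        proof (cases "z \<in> U")
          case True
          let ?C = "connected_component_set U z"
          have C: "?C \<in> components U" "z \<in> ?C"
            using True by (auto simp: components_def)
          have "\<epsilon> constant_on ?C"
            using sign_functions_constant_on[OF \<epsilon>] connected_component_subset by blast
          then have "(\<exists>w\<in>?C. \<epsilon> w = 1) \<longleftrightarrow> \<epsilon> z = 1"
            using C(2) unfolding constant_on_def by metis
          then have "h ?C \<longleftrightarrow> \<epsilon> z = 1"
            using C(1) by (simp add: h_def)
          moreover have "\<epsilon> z \<in> {1, -1}"
            using \<epsilon> True by (auto simp: sign_functions_def)
          ultimately show ?thesis
            using True by (auto simp: signs_of_components_def)
        next
          case False
          then have "\<epsilon> z = undefined"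
            using \<epsilon> by (simp add: sign_functions_def PiE_iff extensional_def)
          with False show ?thesis
            by (simp add: signs_of_components_def)
        qed
      qed
    qed
    then show "signs_of_components U ` Func (components U) UNIV = sign_functions U"
      using signs_of_components_in_sign_functions[OF assms] by blast
  qed
  then have "|Func (components U) (UNIV :: bool set)| =o |sign_functions U|"
    by (rule card_of_ordIsoI)
  then show ?thesis
    by (simp add: cexp_def ctwo_def Field_card_of ordIso_symmetric)
qed

lemma card_ordLeq_cone_iff: "|A| \<le>o cone \<longleftrightarrow> (\<forall>x\<in>A. \<forall>y\<in>A. x = y)"
proof -
  have "|A| \<le>o cone \<longleftrightarrow> (\<exists>f. inj_on f A \<and> f ` A \<subseteq> {()})"
    unfolding BNF_Cardinal_Arithmetic.cone_def by (rule card_of_ordLeq[symmetric])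
  then show ?thesis
    by (auto simp: inj_on_def)
qed

text \<open>The constant sign functions \<open>p\<close> and \<open>n\<close> correspond to
  \<open>f\<close> and \<open>-f\<close>, so the lifts form this pair exactly when every sign
  function is \<open>p\<close> or \<open>n\<close>. With no component at all, \<open>p = n\<close>
  and \<open>f = 0\<close>, and the pair collapses to one element; \<open>cone\<close> as a bound
  covers this case too.\<close>

lemma signed_lifts_pair_iff:
  assumes L: "L > 0" and f: "smooth f" "periodic L f"
  shows "signed_lifts L f = {f, \<lambda>s. - f s} \<longleftrightarrow> num_comps L f \<le>o cone"
proof -
  let ?U = "S1 - Z_inf L f"
  have U: "locally connected ?U"
    using openin_S1_minus_Z_inf[OF L f] locally_connected_sphere locally_open_subset by blast
  define p where "p = signs_of_components ?U (\<lambda>_. True)"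
  define n where "n = signs_of_components ?U (\<lambda>_. False)"
  have pn: "p \<in> sign_functions ?U" "n \<in> sign_functions ?U"
    unfolding p_def n_def by (intro signs_of_components_in_sign_functions U)+
  have app: "apply_signs L f p = f" "apply_signs L f n = (\<lambda>s. - f s)"
    using flat_zero[of f] f L
    by (auto simp: p_def n_def signs_of_components_def apply_signs_def circ_in_Z_inf_iff circ_in_S1)
  have bij: "bij_betw (apply_signs L f) (sign_functions ?U) (signed_lifts L f)"
    by (rule bij_betw_apply_signs[OF L f])
  show ?thesis
    unfolding num_comps_def card_ordLeq_cone_iff
  proof
    assume eq: "signed_lifts L f = {f, \<lambda>s. - f s}"
    have sub: "\<epsilon> = p \<or> \<epsilon> = n" if "\<epsilon> \<in> sign_functions ?U" for \<epsilon>
    proof -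
      have "apply_signs L f \<epsilon> \<in> {apply_signs L f p, apply_signs L f n}"
        using bij that eq app by (auto simp: bij_betw_def)
      then show ?thesis
        using bij that pn by (auto simp: bij_betw_def inj_on_def)
    qed
    show "\<forall>C\<in>components ?U. \<forall>D\<in>components ?U. C = D"
    proof (intro ballI)
      fix C D assume "C \<in> components ?U" "D \<in> components ?U"
      then obtain x y where xy: "x \<in> ?U" "y \<in> ?U" "C = connected_component_set ?U x"
          "D = connected_component_set ?U y"
        by (auto simp: components_def)
      \<comment> \<open>The sign that is 1 exactly on \<open>C\<close> is a test function: being one
        of the two constants, it cannot separate \<open>x\<close> from \<open>y\<close>.\<close>
      let ?e = "signs_of_components ?U (\<lambda>X. X = C)"
      have "?e = p \<or> ?e = n"
        by (intro sub signs_of_components_in_sign_functions U)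
      moreover have "p x = p y" "n x = n y"
        using xy(1,2) by (simp_all add: p_def n_def signs_of_components_def)
      ultimately have "?e x = ?e y"
        by metis
      then show "C = D"
        using xy by (auto simp: signs_of_components_def split: if_splits)
    qed
  next
    assume one: "\<forall>C\<in>components ?U. \<forall>D\<in>components ?U. C = D"
    have "connected ?U"
      unfolding connected_iff_connected_component_eq
    proof (intro ballI)
      fix x y assume x: "x \<in> ?U" and y: "y \<in> ?U"
      show "connected_component_set ?U x = connected_component_set ?U y"
        by (rule one[rule_format, OF componentsI[OF x] componentsI[OF y]])
    qed
    then have const: "\<epsilon> constant_on ?U" if "\<epsilon> \<in> sign_functions ?U" for \<epsilon>
      using that sign_functions_constant_on by blast
    have "\<epsilon> = p \<or> \<epsilon> = n" if \<epsilon>: "\<epsilon> \<in> sign_functions ?U" for \<epsilon>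
    proof -
      obtain c where c: "\<And>z. z \<in> ?U \<Longrightarrow> \<epsilon> z = c"
        using const[OF \<epsilon>] by (auto simp: constant_on_def)
      have val: "\<epsilon> z \<in> {1, -1}" if "z \<in> ?U" for z
        using \<epsilon> that by (auto simp: sign_functions_def)
      have ext: "\<epsilon> z = undefined" if "z \<notin> ?U" for z
        using \<epsilon> that by (simp add: sign_functions_def PiE_iff extensional_def)
      \<comment> \<open>For empty \<open>?U\<close> the constant \<open>c\<close> is arbitrary;
        \<open>\<epsilon>\<close> then agrees with \<open>n\<close> because both are
        \<open>undefined\<close> everywhere.\<close>
      consider "c = 1" | "?U = {} \<or> c = -1"
        using c val by fastforce
      then show ?thesis
        using c ext by cases (auto simp: p_def n_def signs_of_components_def fun_eq_iff)
    qed
    then have "sign_functions ?U = {p, n}"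
      using pn by blast
    then show "signed_lifts L f = {f, \<lambda>s. - f s}"
      using bij app by (auto simp: bij_betw_def)
  qed
qed

section \<open>The Frenet equations\<close>

lemma bounded_bilinear_cross3: "bounded_bilinear cross3"
  using bilinear_cross bilinear_conv_bounded_bilinear by blast

text \<open>The part \<open>y\<close> of \<open>x\<close> orthogonal to \<open>u\<close> and
  \<open>v\<close> has zero cross product with \<open>cross3 u v\<close>, by the double cross
  product formula. The same formula applied once more turns this into \<open>y\<close> being a
  multiple of \<open>cross3 u v\<close>.\<close>

lemma orthonormal_basis_expansion:
  fixes u v x :: "real^3"
  assumes "norm u = 1" "norm v = 1" "u \<bullet> v = 0"
  shows "x = (x \<bullet> u) *\<^sub>R u + (x \<bullet> v) *\<^sub>R v + (x \<bullet> cross3 u v) *\<^sub>R cross3 u v"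
proof -
  have uv: "u \<bullet> u = 1" "v \<bullet> v = 1" "v \<bullet> u = 0"
    using assms by (auto simp: norm_eq_1 inner_commute)
  define y where "y = x - (x \<bullet> u) *\<^sub>R u - (x \<bullet> v) *\<^sub>R v"
  have "y \<bullet> u = 0" "y \<bullet> v = 0"
    using uv assms(3) by (simp_all add: y_def inner_diff_left)
  then have "cross3 (cross3 u v) y = 0"
    using Lagrange[of y u v] cross_skew[of "cross3 u v" y] by (simp add: inner_commute)
  then have yy: "(cross3 u v \<bullet> cross3 u v) *\<^sub>R y = (y \<bullet> cross3 u v) *\<^sub>R cross3 u v"
    using Lagrange[of "cross3 u v" "cross3 u v" y] by (simp add: algebra_simps inner_commute)
  have "cross3 u v \<bullet> cross3 u v = 1"
    using dot_cross[of u v u v] uv assms(3) by simp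
  moreover have "y \<bullet> cross3 u v = x \<bullet> cross3 u v"
    by (simp add: y_def inner_diff_left dot_cross_self)
  ultimately show ?thesis
    using yy by (simp add: y_def algebra_simps)
qed

lemma nth_deriv_2: "nth_deriv 2 f = Dv (Dv f)"
  by (simp add: numeral_2_eq_2 nth_deriv_Suc)

text \<open>Source of the skew symmetry in the Frenet system: it is applied to the six constant
  inner products of the frame vectors.\<close>

lemma inner_const_Dv:
  fixes f g :: "real \<Rightarrow> real^3"
  assumes "smooth f" "smooth g" "\<And>s. f s \<bullet> g s = c"
  shows "f s \<bullet> Dv g s + Dv f s \<bullet> g s = 0"
proof -
  have "((\<lambda>s. f s \<bullet> g s) has_vector_derivative f s \<bullet> Dv g s + Dv f s \<bullet> g s) (at s)"
    by (intro bounded_bilinear.has_vector_derivative[OF bounded_bilinear_inner]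
        smooth_has_vector_derivative assms)
  moreover have "((\<lambda>s. f s \<bullet> g s) has_vector_derivative 0) (at s)"
    by (simp add: assms(3))
  ultimately show ?thesis
    using vector_derivative_unique_at by blast
qed

context
  fixes \<gamma> :: "real \<Rightarrow> real^3" and L :: real
  assumes \<gamma>: "frenet_curve L \<gamma>"
begin

lemma smooth_curve: "smooth \<gamma>" and periodic_curve: "periodic L \<gamma>"
  and norm_tangent: "norm (tangent \<gamma> s) = 1" and curvature_pos: "curvature \<gamma> s > 0"
  using \<gamma> by (auto simp: frenet_curve_def tangent_def)

lemma Dv_curve: "Dv \<gamma> s = tangent \<gamma> s"
  by (simp add: tangent_def)

lemma smooth_tangent: "smooth (tangent \<gamma>)"
  unfolding tangent_def by (intro smooth_Dv smooth_curve)

lemma curvature_eq: "curvature \<gamma> s = norm (Dv (tangent \<gamma>) s)"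
  by (simp add: curvature_def tangent_def nth_deriv_2)

lemma smooth_curvature: "smooth (curvature \<gamma>)"
proof -
  have "Dv (tangent \<gamma>) s \<noteq> 0" for s
    using curvature_pos[of s] by (auto simp: curvature_eq)
  then have "smooth (\<lambda>s. norm (Dv (tangent \<gamma>) s))"
    by (intro smooth_norm smooth_Dv smooth_tangent)
  then show ?thesis
    by (simp add: curvature_eq[abs_def])
qed

lemma smooth_normal: "smooth (normal \<gamma>)"
proof -
  have "smooth (\<lambda>s. Dv (tangent \<gamma>) s /\<^sub>R curvature \<gamma> s)"
    using curvature_pos
    by (intro smooth_bilinear[OF bounded_bilinear_scaleR] smooth_inverse smooth_curvature
        smooth_Dv smooth_tangent) (auto simp: less_imp_neq[symmetric])
  then show ?thesis
    by (simp add: normal_def[abs_def])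
qed

lemma smooth_binormal: "smooth (binormal \<gamma>)"
  using smooth_bilinear[OF bounded_bilinear_cross3 smooth_tangent smooth_normal]
  by (simp add: binormal_def[abs_def])

lemma smooth_torsion: "smooth (torsion \<gamma>)"
  using smooth_minus[OF smooth_bilinear[OF bounded_bilinear_inner smooth_Dv[OF smooth_binormal]
        smooth_normal]]
  by (simp add: torsion_def[abs_def])

lemma periodic_curvature: "periodic L (curvature \<gamma>)"
  using periodic_nth_deriv[OF periodic_curve, of 2] by (simp add: periodic_def curvature_def)

lemma periodic_tangent: "periodic L (tangent \<gamma>)"
  unfolding tangent_def by (intro periodic_Dv periodic_curve)

lemma periodic_normal: "periodic L (normal \<gamma>)"
  using periodic_Dv[OF periodic_tangent] periodic_curvature by (simp add: periodic_def normal_def)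

lemma periodic_torsion: "periodic L (torsion \<gamma>)"
proof -
  have "periodic L (binormal \<gamma>)"
    using periodic_tangent periodic_normal by (simp add: periodic_def binormal_def)
  from periodic_Dv[OF this] show ?thesis
    using periodic_normal by (simp add: periodic_def torsion_def)
qed

lemma Dv_tangent: "Dv (tangent \<gamma>) s = curvature \<gamma> s *\<^sub>R normal \<gamma> s"
  using curvature_pos[of s] by (simp add: normal_def)

lemma norm_normal: "norm (normal \<gamma> s) = 1"
  using curvature_pos[of s] by (simp add: normal_def curvature_eq)

lemma tangent_normal: "tangent \<gamma> s \<bullet> normal \<gamma> s = 0"
proof -
  have "tangent \<gamma> s \<bullet> Dv (tangent \<gamma>) s + Dv (tangent \<gamma>) s \<bullet> tangent \<gamma> s = 0"
    using norm_tangent by (intro inner_const_Dv[where c = 1] smooth_tangent) (simp add: norm_eq_1)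
  then show ?thesis
    using curvature_pos[of s] by (simp add: Dv_tangent inner_commute)
qed

lemma frame_inner:
  "tangent \<gamma> s \<bullet> tangent \<gamma> s = 1" "normal \<gamma> s \<bullet> normal \<gamma> s = 1" "binormal \<gamma> s \<bullet> binormal \<gamma> s = 1"
  "tangent \<gamma> s \<bullet> normal \<gamma> s = 0" "tangent \<gamma> s \<bullet> binormal \<gamma> s = 0" "normal \<gamma> s \<bullet> binormal \<gamma> s = 0"
  using norm_tangent[of s] norm_normal[of s] tangent_normal[of s]
    dot_cross[of "tangent \<gamma> s" "normal \<gamma> s" "tangent \<gamma> s" "normal \<gamma> s"]
  by (simp_all add: norm_eq_1 binormal_def dot_cross_self inner_commute)

lemma frame_expansion:
  "x = (x \<bullet> tangent \<gamma> s) *\<^sub>R tangent \<gamma> s + (x \<bullet> normal \<gamma> s) *\<^sub>R normal \<gamma> s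
     + (x \<bullet> binormal \<gamma> s) *\<^sub>R binormal \<gamma> s"
  unfolding binormal_def
  by (intro orthonormal_basis_expansion norm_tangent norm_normal tangent_normal)

text \<open>Unit length removes the component along the binormal; \<open>T \<bullet> B = 0\<close>
  together with \<open>T'\<close> being parallel to \<open>N\<close> removes the one along the
  tangent. The remaining coefficient is the torsion by definition.\<close>

lemma Dv_binormal: "Dv (binormal \<gamma>) s = - torsion \<gamma> s *\<^sub>R normal \<gamma> s"
proof -
  have "binormal \<gamma> s \<bullet> Dv (binormal \<gamma>) s + Dv (binormal \<gamma>) s \<bullet> binormal \<gamma> s = 0"
    by (rule inner_const_Dv[OF smooth_binormal smooth_binormal frame_inner(3)])
  moreover have "tangent \<gamma> s \<bullet> Dv (binormal \<gamma>) s + Dv (tangent \<gamma>) s \<bullet> binormal \<gamma> s = 0"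
    by (rule inner_const_Dv[OF smooth_tangent smooth_binormal frame_inner(5)])
  ultimately have "Dv (binormal \<gamma>) s \<bullet> binormal \<gamma> s = 0" "Dv (binormal \<gamma>) s \<bullet> tangent \<gamma> s = 0"
    using frame_inner[of s] by (simp_all add: Dv_tangent inner_commute)
  then show ?thesis
    using frame_expansion[of "Dv (binormal \<gamma>) s" s] by (simp add: torsion_def)
qed

lemma Dv_normal: "Dv (normal \<gamma>) s = - curvature \<gamma> s *\<^sub>R tangent \<gamma> s + torsion \<gamma> s *\<^sub>R binormal \<gamma> s"
proof -
  have "normal \<gamma> s \<bullet> Dv (normal \<gamma>) s + Dv (normal \<gamma>) s \<bullet> normal \<gamma> s = 0"
    by (rule inner_const_Dv[OF smooth_normal smooth_normal frame_inner(2)])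
  moreover have "tangent \<gamma> s \<bullet> Dv (normal \<gamma>) s + Dv (tangent \<gamma>) s \<bullet> normal \<gamma> s = 0"
    by (rule inner_const_Dv[OF smooth_tangent smooth_normal frame_inner(4)])
  moreover have "normal \<gamma> s \<bullet> Dv (binormal \<gamma>) s + Dv (normal \<gamma>) s \<bullet> binormal \<gamma> s = 0"
    by (rule inner_const_Dv[OF smooth_normal smooth_binormal frame_inner(6)])
  ultimately have "Dv (normal \<gamma>) s \<bullet> normal \<gamma> s = 0"
      "Dv (normal \<gamma>) s \<bullet> tangent \<gamma> s = - curvature \<gamma> s"
      "Dv (normal \<gamma>) s \<bullet> binormal \<gamma> s = torsion \<gamma> s"
    using frame_inner[of s] by (simp_all add: Dv_tangent Dv_binormal inner_commute)
  then show ?thesis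
    using frame_expansion[of "Dv (normal \<gamma>) s" s] by simp
qed

lemma frame_has_vector_derivative:
  "(\<gamma> has_vector_derivative tangent \<gamma> s) (at s)"
  "(tangent \<gamma> has_vector_derivative curvature \<gamma> s *\<^sub>R normal \<gamma> s) (at s)"
  "(normal \<gamma> has_vector_derivative
      - curvature \<gamma> s *\<^sub>R tangent \<gamma> s + torsion \<gamma> s *\<^sub>R binormal \<gamma> s) (at s)"
  "(binormal \<gamma> has_vector_derivative - torsion \<gamma> s *\<^sub>R normal \<gamma> s) (at s)"
  using smooth_has_vector_derivative[OF smooth_curve, of s, unfolded Dv_curve]
    smooth_has_vector_derivative[OF smooth_tangent, of s, unfolded Dv_tangent]
    smooth_has_vector_derivative[OF smooth_normal, of s, unfolded Dv_normal]
    smooth_has_vector_derivative[OF smooth_binormal, of s, unfolded Dv_binormal]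
  by (-) (assumption+)

end

section \<open>Rigid motions and uniqueness\<close>

lemma nth_deriv_isometry:
  fixes Q :: "real^3^3"
  assumes "smooth \<gamma>" "k > 0"
  shows "nth_deriv k (\<lambda>s. Q *v \<gamma> s + a) = (\<lambda>s. Q *v nth_deriv k \<gamma> s)"
proof -
  obtain j where j: "k = Suc j"
    using assms(2) gr0_implies_Suc by blast
  have "((\<lambda>s. Q *v \<gamma> s + a) has_vector_derivative Q *v Dv \<gamma> s) (at s)" for s
    using has_vector_derivative_add[OF bounded_linear.has_vector_derivative[OF
          matrix_vector_mul_bounded_linear smooth_has_vector_derivative[OF assms(1)]]
        has_vector_derivative_const] by simp
  then have "Dv (\<lambda>s. Q *v \<gamma> s + a) = (\<lambda>s. Q *v Dv \<gamma> s)"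
    by (rule Dv_eqI)
  then show ?thesis
    using nth_deriv_linear[OF matrix_vector_mul_bounded_linear smooth_Dv[OF assms(1)]]
    by (simp add: j nth_deriv_Suc')
qed

text \<open>Tangent and normal are carried along by \<open>Q\<close>, but the cross product of two
  images acquires the factor \<open>det Q\<close>. It enters the binormal and hence the torsion, so
  a reflection reverses the sign of the torsion.\<close>

lemma isometry_frenet:
  fixes Q :: "real^3^3"
  assumes \<gamma>: "frenet_curve L \<gamma>" and Q: "orthogonal_matrix Q"
  shows "frenet_curve L (\<lambda>s. Q *v \<gamma> s + a)" (is "frenet_curve L ?\<beta>")
    and "curvature (\<lambda>s. Q *v \<gamma> s + a) = curvature \<gamma>"
    and "torsion (\<lambda>s. Q *v \<gamma> s + a) = (\<lambda>s. det Q * torsion \<gamma> s)"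
proof -
  have sm: "smooth \<gamma>"
    by (rule smooth_curve[OF \<gamma>])
  have orth: "orthogonal_transformation ((*v) Q)"
    using Q by (simp add: orthogonal_transformation_matrix)
  have inner: "(Q *v x) \<bullet> (Q *v y) = x \<bullet> y" for x y
    using orth by (simp add: orthogonal_transformation_def)
  have norm: "norm (Q *v x) = norm x" for x
    using orth by (rule orthogonal_transformation_norm)
  show curv: "curvature ?\<beta> = curvature \<gamma>"
    by (simp add: fun_eq_iff curvature_def nth_deriv_isometry[OF sm] norm)
  have D: "Dv ?\<beta> = (\<lambda>s. Q *v Dv \<gamma> s)"
    using nth_deriv_isometry[OF sm, of 1 Q a] by (simp add: nth_deriv_Suc)
  have "smooth ?\<beta>"
    by (intro smooth_add smooth_const smooth_linear[OF matrix_vector_mul_bounded_linear] sm)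
  moreover have "periodic L ?\<beta>"
    using periodic_curve[OF \<gamma>] by (simp add: periodic_def)
  moreover have "inj ((*v) Q)"
    using orth by (rule orthogonal_transformation_inj)
  then have "inj_on ?\<beta> {0..<L}"
    using \<gamma> unfolding frenet_curve_def inj_on_def by simp
  ultimately show "frenet_curve L ?\<beta>"
    using \<gamma> by (simp add: frenet_curve_def fun_cong[OF D] norm curv)
  have T: "tangent ?\<beta> = (\<lambda>s. Q *v tangent \<gamma> s)"
    by (simp add: tangent_def D)
  have "Dv (tangent ?\<beta>) = (\<lambda>s. Q *v Dv (tangent \<gamma>) s)"
    unfolding T
    using nth_deriv_linear[OF matrix_vector_mul_bounded_linear smooth_tangent[OF \<gamma>], of 1 Q]
    by (simp add: nth_deriv_Suc)
  then have N: "normal ?\<beta> = (\<lambda>s. Q *v normal \<gamma> s)"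
    by (simp add: fun_eq_iff normal_def curv matrix_vector_mult_scaleR)
  have B: "binormal ?\<beta> = (\<lambda>s. det Q *\<^sub>R (Q *v binormal \<gamma> s))"
    by (simp add: fun_eq_iff binormal_def T N cross_orthogonal_matrix[OF Q])
  have "Dv (\<lambda>s. det Q *\<^sub>R (Q *v binormal \<gamma> s)) = (\<lambda>s. det Q *\<^sub>R (Q *v Dv (binormal \<gamma>) s))"
    using nth_deriv_linear[OF bounded_linear_compose[OF bounded_linear_scaleR_right
          matrix_vector_mul_bounded_linear] smooth_binormal[OF \<gamma>], of 1 "det Q" Q]
    by (simp add: nth_deriv_Suc)
  then have "Dv (binormal ?\<beta>) s = det Q *\<^sub>R (Q *v Dv (binormal \<gamma>) s)" for s
    unfolding B by (rule fun_cong)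
  then show "torsion ?\<beta> = (\<lambda>s. det Q * torsion \<gamma> s)"
    by (simp add: fun_eq_iff torsion_def N inner)
qed

text \<open>The linear map carrying the Frenet frame of \<open>\<alpha>\<close> at \<open>s\<close> to that of \<open>\<beta>\<close> at \<open>s\<close> does not
  depend on \<open>s\<close>, because both frames satisfy the same linear system with a skew matrix.\<close>

lemma frenet_uniqueness:
  assumes \<alpha>: "frenet_curve L \<alpha>" and \<beta>: "frenet_curve L \<beta>"
    and k: "curvature \<beta> = curvature \<alpha>" and t: "torsion \<beta> = torsion \<alpha>"
  obtains Q a where "rotation_matrix Q" "\<beta> = (\<lambda>s. Q *v \<alpha> s + a)"
proof -
  define M where "M s x = (x \<bullet> tangent \<alpha> s) *\<^sub>R tangent \<beta> s + (x \<bullet> normal \<alpha> s) *\<^sub>R normal \<beta> s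
     + (x \<bullet> binormal \<alpha> s) *\<^sub>R binormal \<beta> s" for s x
  note Da = frame_has_vector_derivative[OF \<alpha>] and Db = frame_has_vector_derivative[OF \<beta>, unfolded k t]
  have "((\<lambda>s. M s x) has_vector_derivative 0) (at s)" for s x
    unfolding M_def
    apply (rule has_vector_derivative_eq_rhs)
     apply (rule has_vector_derivative_add has_vector_derivative_const Da Db
        bounded_bilinear.has_vector_derivative[OF bounded_bilinear_scaleR]
        bounded_bilinear.has_vector_derivative[OF bounded_bilinear_inner]
        bounded_linear.has_vector_derivative[OF bounded_linear_inner_right])+
    by (simp add: algebra_simps inner_add_right)
  then have "M s x = M 0 x" for s x
    using has_vector_derivative_zero_constant[of UNIV "\<lambda>s. M s x"]
    by (metis UNIV_I convex_UNIV)
  then have M0: "M s = M 0" for s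
    by (simp add: fun_eq_iff)
  have lin: "linear (M 0)"
    unfolding M_def by (intro linearI) (simp_all add: algebra_simps inner_add_left)
  define Q where "Q = matrix (M 0)"
  have Q: "Q *v x = M s x" for s x
    using M0[of s] lin by (simp add: Q_def)
  have QT: "Q *v tangent \<alpha> s = tangent \<beta> s" and QN: "Q *v normal \<alpha> s = normal \<beta> s"
    and QB: "Q *v binormal \<alpha> s = binormal \<beta> s" for s
    using frame_inner[OF \<alpha>, of s] by (simp_all add: Q[of _ s] M_def inner_commute)
  have "norm (Q *v x) = norm x" for x
  proof -
    have "(Q *v x) \<bullet> (Q *v x) = (x \<bullet> tangent \<alpha> 0)^2 + (x \<bullet> normal \<alpha> 0)^2 + (x \<bullet> binormal \<alpha> 0)^2"
      using frame_inner[OF \<beta>, of 0]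
      by (simp add: Q[of _ 0] M_def inner_add_left inner_add_right inner_commute power2_eq_square)
    also have "\<dots> = x \<bullet> x"
    proof -
      have "x \<bullet> x = x \<bullet> ((x \<bullet> tangent \<alpha> 0) *\<^sub>R tangent \<alpha> 0 + (x \<bullet> normal \<alpha> 0) *\<^sub>R normal \<alpha> 0
          + (x \<bullet> binormal \<alpha> 0) *\<^sub>R binormal \<alpha> 0)"
        using frame_expansion[OF \<alpha>, of x 0] by simp
      also have "\<dots> = (x \<bullet> tangent \<alpha> 0)^2 + (x \<bullet> normal \<alpha> 0)^2 + (x \<bullet> binormal \<alpha> 0)^2"
        by (simp add: inner_add_right power2_eq_square)
      finally show ?thesis by simp
    qed
    finally show ?thesis
      by (simp add: norm_eq_sqrt_inner)
  qed
  then have "orthogonal_transformation ((*v) Q)"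
    by (simp add: orthogonal_transformation)
  then have orth: "orthogonal_matrix Q"
    by (simp add: orthogonal_transformation_matrix)
  \<comment> \<open>Both binormals are cross products of tangent and normal, so \<open>Q\<close>
    matching all three frame vectors leaves no room for the factor \<open>det Q\<close>.\<close>
  have "binormal \<beta> 0 = det Q *\<^sub>R binormal \<beta> 0"
    using cross_orthogonal_matrix[OF orth, of "tangent \<alpha> 0" "normal \<alpha> 0"]
    unfolding QT QN binormal_def[symmetric] QB .
  then have "det Q * (binormal \<beta> 0 \<bullet> binormal \<beta> 0) = binormal \<beta> 0 \<bullet> binormal \<beta> 0"
    by (metis inner_scaleR_left)
  then have rot: "rotation_matrix Q"
    using orth frame_inner(3)[OF \<beta>, of 0] by (simp add: rotation_matrix_def)
  have "((\<lambda>s. \<beta> s - Q *v \<alpha> s) has_vector_derivative tangent \<beta> s - Q *v tangent \<alpha> s) (at s)" for s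
    by (intro has_vector_derivative_diff Db bounded_linear.has_vector_derivative[OF
          matrix_vector_mul_bounded_linear] Da)
  then have "((\<lambda>s. \<beta> s - Q *v \<alpha> s) has_vector_derivative 0) (at s)" for s
    by (simp add: QT)
  then obtain a where "\<And>s. \<beta> s - Q *v \<alpha> s = a"
    using has_vector_derivative_zero_constant[of UNIV "\<lambda>s. \<beta> s - Q *v \<alpha> s"]
    by (metis UNIV_I convex_UNIV)
  then have "\<beta> = (\<lambda>s. Q *v \<alpha> s + a)"
    by (auto simp: fun_eq_iff algebra_simps)
  with rot show ?thesis
    using that by blast
qed

section \<open>Rigid motions are isotopic to the identity\<close>

abbreviation is_homeomorphism :: "('a::topological_space \<Rightarrow> 'a) \<Rightarrow> bool" where
  "is_homeomorphism f \<equiv> \<exists>g. homeomorphism UNIV UNIV f g"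

definition isotopic_to_id :: "('a::topological_space \<Rightarrow> 'a) \<Rightarrow> bool" where
  "isotopic_to_id f \<longleftrightarrow> homotopic_with_canon is_homeomorphism UNIV UNIV id f"

lemma is_homeomorphism_comp: "is_homeomorphism f \<Longrightarrow> is_homeomorphism g \<Longrightarrow> is_homeomorphism (f \<circ> g)"
  by (meson homeomorphism_compose)

lemma isotopic_to_id_homeomorphism: "isotopic_to_id f \<Longrightarrow> is_homeomorphism f"
  unfolding isotopic_to_id_def using homotopic_with_imp_property by blast

lemma homeomorphism_UNIV_continuous: "homeomorphism UNIV UNIV f g \<Longrightarrow> continuous_on UNIV f"
  by (simp add: homeomorphism_def)

text \<open>Composing the isotopy from \<open>id\<close> to \<open>g\<close> with \<open>f\<close>
  on the left gives one from \<open>f\<close> to \<open>f \<circ> g\<close>, which is appended to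
  the isotopy from \<open>id\<close> to \<open>f\<close>.\<close>

lemma isotopic_to_id_comp:
  assumes f: "isotopic_to_id f" and g: "isotopic_to_id g"
  shows "isotopic_to_id (f \<circ> g)"
proof -
  have hf: "is_homeomorphism f"
    using f by (rule isotopic_to_id_homeomorphism)
  have "homotopic_with_canon (\<lambda>k. is_homeomorphism (f \<circ> k)) UNIV UNIV id g"
    using g[unfolded isotopic_to_id_def]
    by (rule homotopic_with_mono) (rule is_homeomorphism_comp[OF hf])
  then have "homotopic_with_canon is_homeomorphism UNIV UNIV (f \<circ> id) (f \<circ> g)"
    using hf homeomorphism_UNIV_continuous by (intro homotopic_with_compose_continuous_left[where Y = UNIV]) auto
  then show ?thesis
    using f unfolding isotopic_to_id_def by (simp add: homotopic_with_trans)
qed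

text \<open>Composing the isotopy from \<open>id\<close> to \<open>f\<close> with \<open>g\<close>
  on the right gives one from \<open>g\<close> to \<open>f \<circ> g = id\<close>, which is then
  reversed. The inverses of the intermediate homeomorphisms need not be assembled into an
  isotopy.\<close>

lemma isotopic_to_id_inverse:
  assumes f: "isotopic_to_id f" and g: "homeomorphism UNIV UNIV f g"
  shows "isotopic_to_id g"
proof -
  have hg: "homeomorphism UNIV UNIV g f"
    using g by (simp add: homeomorphism_symD)
  then have "is_homeomorphism (k \<circ> g)" if "is_homeomorphism k" for k
    using that is_homeomorphism_comp by blast
  with f have "homotopic_with_canon (\<lambda>k. is_homeomorphism (k \<circ> g)) UNIV UNIV id f"
    unfolding isotopic_to_id_def by (rule homotopic_with_mono)
  then have "homotopic_with_canon is_homeomorphism UNIV UNIV (id \<circ> g) (f \<circ> g)"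
    using homeomorphism_UNIV_continuous[OF hg] by (intro homotopic_with_compose_continuous_right[where X = UNIV and Y = UNIV]) auto
  moreover have "f \<circ> g = id"
    using g by (auto simp: homeomorphism_def)
  ultimately show ?thesis
    unfolding isotopic_to_id_def by (simp add: homotopic_with_symD)
qed

lemma isotopic_to_idI:
  fixes h :: "real \<times> 'a::real_normed_vector \<Rightarrow> 'a"
  assumes "continuous_on ({0..1} \<times> UNIV) h" "\<And>x. h (0, x) = x" "\<And>x. h (1, x) = f x"
    and "\<And>t. t \<in> {0..1} \<Longrightarrow> is_homeomorphism (\<lambda>x. h (t, x))"
  shows "isotopic_to_id f"
proof -
  have "prod_topology (top_of_set {0..1::real}) (top_of_set (UNIV :: 'a set)) = top_of_set ({0..1} \<times> UNIV)"
    by (rule prod_topology_subtopology_eu)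
  then have "continuous_map (prod_topology (top_of_set {0..1}) (top_of_set UNIV)) (top_of_set UNIV) h"
    using assms(1) by simp
  with assms(2-) show ?thesis
    unfolding isotopic_to_id_def homotopic_with_def by (intro exI[of _ h]) auto
qed

lemma ambient_isotopic_iff: "ambient_isotopic K K' \<longleftrightarrow> (\<exists>h. isotopic_to_id h \<and> h ` K = K')"
  by (simp add: ambient_isotopic_def isotopic_to_id_def)

lemma knot_type_isotopic:
  assumes "isotopic_to_id f"
  shows "knot_type (f ` K) = knot_type K"
proof (intro set_eqI iffI)
  obtain g where g: "homeomorphism UNIV UNIV f g"
    using isotopic_to_id_homeomorphism[OF assms] by blast
  have gf: "g (f x) = x" for x
    using g by (simp add: homeomorphism_def)
  fix K'
  {
    assume "K' \<in> knot_type (f ` K)"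
    then obtain h where "isotopic_to_id h" "h ` f ` K = K'"
      by (auto simp: knot_type_def ambient_isotopic_iff)
    with assms show "K' \<in> knot_type K"
      by (auto simp: knot_type_def ambient_isotopic_iff image_comp
          intro!: exI[of _ "h \<circ> f"] isotopic_to_id_comp)
  next
    assume "K' \<in> knot_type K"
    then obtain h where "isotopic_to_id h" "h ` K = K'"
      by (auto simp: knot_type_def ambient_isotopic_iff)
    with isotopic_to_id_inverse[OF assms g] show "K' \<in> knot_type (f ` K)"
      by (auto simp: knot_type_def ambient_isotopic_iff image_image gf
          intro!: exI[of _ "h \<circ> g"] isotopic_to_id_comp)
  }
qed

lemma homeomorphism_translation: "homeomorphism UNIV UNIV (\<lambda>x::'a::real_normed_vector. x + a) (\<lambda>x. x - a)"
  by (auto simp: homeomorphism_def surj_def intro!: continuous_intros exI[of _ "_ - a"] exI[of _ "_ + a"])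

lemma isotopic_to_id_translation: "isotopic_to_id (\<lambda>x::'a::real_normed_vector. x + a)"
proof (rule isotopic_to_idI)
  show "continuous_on ({0..1} \<times> UNIV) (\<lambda>(t, x). x + t *\<^sub>R a)"
    unfolding case_prod_beta by (intro continuous_intros)
qed (use homeomorphism_translation in auto)

section \<open>Reflections and the decomposition of rotations\<close>

definition reflect :: "real^3 \<Rightarrow> real^3 \<Rightarrow> real^3" where
  "reflect n x = x - (2 * (x \<bullet> n)) *\<^sub>R n"

definition reflect_matrix :: "real^3 \<Rightarrow> real^3^3" where
  "reflect_matrix n = matrix (reflect n)"

lemma linear_reflect: "linear (reflect n)"
  by (intro linearI) (simp_all add: reflect_def inner_add_left algebra_simps)

lemma reflect_matrix_works: "reflect_matrix n *v x = reflect n x"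
  unfolding reflect_matrix_def by (simp add: linear_reflect)

lemma reflect_orthogonal: "x \<bullet> n = 0 \<Longrightarrow> reflect n x = x"
  by (simp add: reflect_def)

text \<open>The matrix is the identity minus twice the rank-one matrix \<open>n n^T\<close>, whose
  determinant is \<open>1 - 2 (n \<bullet> n)\<close>.\<close>

lemma det_reflect_matrix:
  assumes "norm n = 1"
  shows "det (reflect_matrix n) = - 1"
proof -
  have n: "n$1 * n$1 + n$2 * n$2 + n$3 * n$3 = 1"
    using assms by (simp add: norm_eq_1 inner_vec_def sum_3)
  have entry: "reflect_matrix n $ i $ j = (if i = j then 1 else 0) - 2 * n$i * n$j" for i j
  proof -
    have "reflect_matrix n $ i $ j = axis j 1 $ i - 2 * n$i * n$j"
      by (simp add: reflect_matrix_def matrix_def reflect_def inner_axis')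
    then show ?thesis
      by (auto simp: axis_def)
  qed
  have "det (reflect_matrix n) = 1 - 2 * (n$1 * n$1 + n$2 * n$2 + n$3 * n$3)"
    unfolding det_3 entry by (simp add: algebra_simps)
  with n show ?thesis by simp
qed

context
  fixes n :: "real^3"
  assumes n: "norm n = 1"
begin

lemma reflect_reflect: "reflect n (reflect n x) = x"
  using n by (simp add: reflect_def inner_diff_left norm_eq_1)

lemma homeomorphism_reflect: "homeomorphism UNIV UNIV (reflect n) (reflect n)"
proof -
  have "continuous_on UNIV (reflect n)"
    by (intro linear_continuous_on) (simp add: linear_reflect linear_conv_bounded_linear[symmetric])
  moreover have "surj (reflect n)"
    using reflect_reflect by (rule surjI)
  ultimately show ?thesis
    by (simp add: homeomorphism_def reflect_reflect)
qed

lemma orthogonal_reflect_matrix: "orthogonal_matrix (reflect_matrix n)"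
proof -
  have "reflect n x \<bullet> reflect n x = x \<bullet> x" for x
    using n by (simp add: reflect_def inner_diff_left inner_diff_right norm_eq_1 inner_commute algebra_simps)
  then have "norm (reflect_matrix n *v x) = norm x" for x
    by (simp add: reflect_matrix_works norm_eq_sqrt_inner)
  then show ?thesis
    using orthogonal_transformation_matrix[of "(*v) (reflect_matrix n)"]
    by (simp add: orthogonal_transformation)
qed

end

lemma isotopic_to_id_two_reflections:
  assumes n: "norm n = 1" and m: "norm m = 1"
  shows "isotopic_to_id (reflect n \<circ> reflect m)"
proof -
  have "path_connected (sphere (0 :: real^3) 1)"
    by (intro path_connected_sphere) simp
  then obtain p where p: "path p" "path_image p \<subseteq> sphere 0 1" "pathstart p = n" "pathfinish p = m"
    using n m unfolding path_connected_def by (metis mem_sphere_0)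
  have pt: "norm (p t) = 1" if "t \<in> {0..1}" for t
    using p(2) that unfolding path_image_def by (metis imageI mem_sphere_0 subsetD)
  show ?thesis
  proof (rule isotopic_to_idI)
    have "continuous_on ({0..1} \<times> UNIV) (\<lambda>z :: real \<times> (real^3). p (fst z))"
      using p(1) unfolding path_def
      by (rule continuous_on_compose2) (auto intro: continuous_intros)
    then show "continuous_on ({0..1} \<times> UNIV) (\<lambda>(t, x). reflect n (reflect (p t) x))"
      unfolding case_prod_beta reflect_def by (intro continuous_intros)
    show "is_homeomorphism (\<lambda>x. case (t, x) of (t, x) \<Rightarrow> reflect n (reflect (p t) x))"
      if "t \<in> {0..1}" for t
      using is_homeomorphism_comp[of "reflect n" "reflect (p t)"] homeomorphism_reflect[OF n]
        homeomorphism_reflect[OF pt[OF that]] by (auto simp: o_def)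
  qed (use p n in \<open>auto simp: pathstart_def pathfinish_def reflect_reflect\<close>)
qed

text \<open>First \<open>a\<close> is reflected to \<open>-a\<close> with normal \<open>a\<close>;
  then \<open>-a\<close> goes to \<open>b\<close> by the reflection with normal along
  \<open>a + b\<close>. Both normals are orthogonal to \<open>c\<close>, so \<open>c\<close> stays
  fixed. Only \<open>b = -a\<close> needs a different second normal.\<close>

lemma two_reflections_obtain:
  fixes a b c :: "real^3"
  assumes a: "norm a = 1" and b: "norm b = 1" and c: "a \<bullet> c = 0" "b \<bullet> c = 0"
  obtains n m where "norm n = 1" "norm m = 1" "reflect n (reflect m a) = b"
    "reflect n (reflect m c) = c"
proof -
  have aa: "a \<bullet> a = 1" "b \<bullet> b = 1"
    using a b by (auto simp: norm_eq_1)
  have ra: "reflect a a = - a"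
    using aa by (simp add: reflect_def scaleR_2)
  have ca: "reflect a c = c"
    using c by (intro reflect_orthogonal) (simp add: inner_commute)
  show ?thesis
  proof (cases "b = - a")
    case True
    \<comment> \<open>Here \<open>a\<close> is already at its target after one reflection. The
      second one must do nothing to \<open>a\<close> and \<open>c\<close>, so its normal is taken
      orthogonal to both, which three dimensions permit.\<close>
    have "dim {a, c} \<le> card {a, c}"
      by (intro dim_le_card') simp
    also have "\<dots> < DIM(real^3)"
      using card_insert_le_m1[of 2 "{c}" a] by simp
    finally obtain x where x: "x \<noteq> 0" "\<And>y. y \<in> span {a, c} \<Longrightarrow> orthogonal x y"
      using orthogonal_to_subspace_exists by blast
    then have "x \<bullet> a = 0" "x \<bullet> c = 0"
      by (simp_all add: orthogonal_def span_base)
    then have "a \<bullet> (x /\<^sub>R norm x) = 0" "c \<bullet> (x /\<^sub>R norm x) = 0" "norm (x /\<^sub>R norm x) = 1"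
      using x(1) by (simp_all add: inner_commute)
    then show ?thesis
      using that[of "x /\<^sub>R norm x" a] a True ra ca by (simp add: reflect_orthogonal)
  next
    case False
    then have ab: "a + b \<noteq> 0"
      by (metis add_eq_0_iff)
    define n where "n = (a + b) /\<^sub>R norm (a + b)"
    have n: "norm n = 1"
      using ab by (simp add: n_def)
    \<comment> \<open>For unit vectors this makes the projection of \<open>a\<close> onto the line
      of \<open>a + b\<close> equal to half of \<open>a + b\<close>, so reflecting \<open>-a\<close>
      adds exactly \<open>a + b\<close>.\<close>
    have sq: "(a + b) \<bullet> (a + b) = 2 * (a \<bullet> (a + b))"
      using aa by (simp add: inner_add_left inner_add_right inner_commute)
    have "(2 * (a \<bullet> n)) *\<^sub>R n = ((2 * (a \<bullet> (a + b))) / (norm (a + b))\<^sup>2) *\<^sub>R (a + b)"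
      by (simp add: n_def power2_eq_square divide_simps)
    also have "\<dots> = a + b"
      using ab by (simp add: sq[symmetric] power2_norm_eq_inner[symmetric])
    finally have "reflect n (- a) = b"
      by (simp add: reflect_def)
    moreover have "reflect n c = c"
      using c by (intro reflect_orthogonal) (simp add: n_def inner_add_right inner_commute)
    ultimately show ?thesis
      using that[OF n a] ra ca by simp
  qed
qed

text \<open>One pair of reflections brings \<open>Q *v e1\<close> back to \<open>e1\<close>, a
  second pair brings the image of \<open>e2\<close> back without moving \<open>e1\<close>. A
  rotation fixing \<open>e1\<close> and \<open>e2\<close> fixes their cross product, hence is the
  identity; solving for \<open>Q\<close> leaves two pairs.\<close>

lemma isotopic_to_id_rotation:
  assumes "rotation_matrix (Q :: real^3^3)"
  shows "isotopic_to_id ((*v) Q)"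
proof -
  define e1 e2 e3 :: "real^3" where "e1 = axis 1 1" and "e2 = axis 2 1" and "e3 = axis 3 1"
  have e: "norm e1 = 1" "norm e2 = 1" "e1 \<bullet> e2 = 0" "cross3 e1 e2 = e3"
    by (simp_all add: e1_def e2_def e3_def norm_axis_1 inner_axis_axis cross_basis)
  have inner: "(A *v x) \<bullet> (A *v y) = x \<bullet> y" and norm: "norm (A *v x) = norm x"
    if "orthogonal_matrix A" for A :: "real^3^3" and x y
    using that orthogonal_transformation_matrix[of "(*v) A"]
    by (auto simp: orthogonal_transformation_def orthogonal_transformation_norm)
  have Q: "orthogonal_matrix Q" "det Q = 1"
    using assms by (auto simp: rotation_matrix_def)
  \<comment> \<open>Nothing has to be kept fixed yet, so \<open>c = 0\<close>.\<close>
  obtain n m where nm: "norm n = 1" "norm m = 1" "reflect n (reflect m (Q *v e1)) = e1"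
    using two_reflections_obtain[of "Q *v e1" e1 0] norm[OF Q(1), of e1] e(1) inner_zero_right
    by metis
  define P where "P = reflect_matrix n ** reflect_matrix m ** Q"
  have P: "orthogonal_matrix P" "det P = 1" "P *v x = reflect n (reflect m (Q *v x))" for x
    using nm Q by (simp_all add: P_def orthogonal_matrix_mul orthogonal_reflect_matrix det_mul
        det_reflect_matrix matrix_vector_mul_assoc[symmetric] reflect_matrix_works)
  have "(P *v e2) \<bullet> e1 = 0"
    using inner[OF P(1), of e2 e1] nm P(3)[of e1] e by (simp add: inner_commute)
  then obtain n' m' where nm': "norm n' = 1" "norm m' = 1"
      "reflect n' (reflect m' (P *v e2)) = e2" "reflect n' (reflect m' e1) = e1"
    using two_reflections_obtain[of "P *v e2" e2 e1] norm[OF P(1), of e2] e(2,3) inner_commute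
    by metis
  define R where "R = reflect_matrix n' ** reflect_matrix m' ** P"
  have R: "orthogonal_matrix R" "det R = 1" "R *v x = reflect n' (reflect m' (P *v x))" for x
    using nm' P by (simp_all add: R_def orthogonal_matrix_mul orthogonal_reflect_matrix det_mul
        det_reflect_matrix matrix_vector_mul_assoc[symmetric] reflect_matrix_works)
  have R12: "R *v e1 = e1" "R *v e2 = e2"
    using R(3) nm' nm(3) P(3) by simp_all
  moreover have "R *v e3 = e3"
    using cross_orthogonal_matrix[OF R(1), of e1 e2] R(2) e R12 by simp
  moreover have "x = x$1 *\<^sub>R e1 + x$2 *\<^sub>R e2 + x$3 *\<^sub>R e3" for x
    by (simp add: vec_eq_iff forall_3 e1_def e2_def e3_def axis_def)
  ultimately have "R *v x = x" for x
    by (metis matrix_vector_right_distrib matrix_vector_mult_scaleR)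
  then have "reflect n' (reflect m' (reflect n (reflect m (Q *v x)))) = x" for x
    using R(3) P(3) by simp
  then have "Q *v x = reflect m (reflect n (reflect m' (reflect n' x)))" for x
    using reflect_reflect nm nm' by metis
  then have "(*v) Q = (reflect m \<circ> reflect n) \<circ> (reflect m' \<circ> reflect n')"
    by auto
  then show ?thesis
    using isotopic_to_id_comp isotopic_to_id_two_reflections nm nm' by metis
qed

lemma isotopic_to_id_SE3: "g \<in> SE3 \<Longrightarrow> isotopic_to_id g"
proof -
  assume "g \<in> SE3"
  then obtain Q a where Q: "rotation_matrix Q" "g = (\<lambda>x. Q *v x + a)"
    by (auto simp: SE3_def)
  then have "g = (\<lambda>x. x + a) \<circ> ((*v) Q)"
    by auto
  then show "isotopic_to_id g"
    using isotopic_to_id_comp isotopic_to_id_translation isotopic_to_id_rotation[OF Q(1)] by metis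
qed

section \<open>Number of components\<close>

lemma num_comps_ordLeq_cone:
  assumes "connected (S1 - Z_inf L f)"
  shows "num_comps L f \<le>o cone"
proof -
  have "components (S1 - Z_inf L f) = {} \<or> components (S1 - Z_inf L f) = {S1 - Z_inf L f}"
    using assms components_empty components_eq_sing_iff by metis
  then show ?thesis
    unfolding num_comps_def card_ordLeq_cone_iff by (metis empty_iff singletonD)
qed

lemma num_comps_no_flat_points:
  assumes "\<And>s. \<not> flat f s"
  shows "num_comps L f \<le>o cone"
proof (rule num_comps_ordLeq_cone)
  have "Z_inf L f = {}"
    using assms by (simp add: Z_inf_def flat_def)
  then show "connected (S1 - Z_inf L f)"
    by (simp add: connected_sphere)
qed

lemma not_flat_zero_order: "zero_order f s < \<infinity> \<Longrightarrow> \<not> flat f s"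
proof
  assume "zero_order f s < \<infinity>" "flat f s"
  then show False
    by (simp add: zero_order_def flat_def top_enat_def[symmetric])
qed

section \<open>Real-analytic curves\<close>

text \<open>Analyticity is recast as an expansion by a formal power series at \<open>p\<close>,
  shifted to 0, since such expansions can be multiplied and differentiated. Vector-valued curves are
  treated coordinate by coordinate.\<close>

definition analytic_germ :: "(real \<Rightarrow> real) \<Rightarrow> real \<Rightarrow> bool" where
  "analytic_germ f p \<longleftrightarrow> (\<exists>F. (\<lambda>t. f (p + t)) has_fps_expansion F)"

lemma analytic_germ_mult: "analytic_germ f p \<Longrightarrow> analytic_germ g p \<Longrightarrow> analytic_germ (\<lambda>s. f s * g s) p"
  unfolding analytic_germ_def using has_fps_expansion_mult by blast

lemma analytic_germ_add: "analytic_germ f p \<Longrightarrow> analytic_germ g p \<Longrightarrow> analytic_germ (\<lambda>s. f s + g s) p"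
  unfolding analytic_germ_def using has_fps_expansion_add by blast

lemma analytic_germ_diff: "analytic_germ f p \<Longrightarrow> analytic_germ g p \<Longrightarrow> analytic_germ (\<lambda>s. f s - g s) p"
  unfolding analytic_germ_def using has_fps_expansion_diff by blast

lemma has_fps_expansion_Dv:
  assumes "smooth f" "(\<lambda>t. f (p + t)) has_fps_expansion F"
  shows "(\<lambda>t. Dv f (p + t)) has_fps_expansion fps_deriv F"
proof -
  have "((\<lambda>t. f (p + t)) has_vector_derivative Dv f (p + t)) (at t)" for t
    using has_vector_derivative_translate[of f p "Dv f (p + t)" t]
      smooth_has_vector_derivative[OF assms(1), of "p + t"] by (simp add: add.commute)
  then have "deriv (\<lambda>t. f (p + t)) = (\<lambda>t. Dv f (p + t))"
    by (auto simp: has_real_derivative_iff_has_vector_derivative intro!: DERIV_imp_deriv)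
  then show ?thesis
    using has_fps_expansion_deriv[OF assms(2)] by simp
qed

lemma analytic_germ_Dv: "smooth f \<Longrightarrow> analytic_germ f p \<Longrightarrow> analytic_germ (Dv f) p"
  unfolding analytic_germ_def using has_fps_expansion_Dv by blast

text \<open>The constant coefficient is \<open>f p = 0\<close>. Higher coefficients are, up to
  positive integer factors, lower coefficients of the formal derivative, which expands the again
  flat function \<open>Dv f\<close>. So the series is zero and represents \<open>f\<close> near
  \<open>p\<close>.\<close>

lemma flat_analytic_germ:
  assumes "smooth f" "flat f p" "analytic_germ f p"
  shows "eventually (\<lambda>s. f s = 0) (nhds p)"
proof -
  obtain F where F: "(\<lambda>t. f (p + t)) has_fps_expansion F"
    using assms(3) by (auto simp: analytic_germ_def)
  have "fps_nth F n = 0" for n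
    using assms(1,2) F
  proof (induction n arbitrary: f F)
    case 0
    have "eventually (\<lambda>t. eval_fps F t = f (p + t)) (nhds 0)"
      using "0.prems"(3) by (simp add: has_fps_expansion_def)
    then have "eval_fps F 0 = f (p + 0)"
      by (rule eventually_nhds_x_imp_x)
    with 0 show ?case
      by (simp add: eval_fps_at_0 flat_zero)
  next
    case (Suc n)
    have "fps_nth (fps_deriv F) n = 0"
      using Suc.prems by (intro Suc.IH[of "Dv f"] smooth_Dv flat_Dv has_fps_expansion_Dv)
    then show ?case
      by simp
  qed
  then have "F = 0"
    by (simp add: fps_eq_iff)
  have "eventually (\<lambda>t. eval_fps F t = f (p + t)) (nhds 0)"
    using F by (simp add: has_fps_expansion_def)
  then have "eventually (\<lambda>t. f (p + t) = 0) (nhds 0)"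
    by eventually_elim (simp add: \<open>F = 0\<close> eval_fps_def)
  moreover have "((\<lambda>s. s - p) \<longlongrightarrow> p - p) (nhds p)"
    by (intro tendsto_diff tendsto_const) (simp add: filterlim_ident)
  then have "filterlim (\<lambda>s. s - p) (nhds 0) (nhds p)"
    by simp
  ultimately have "eventually (\<lambda>s. f (p + (s - p)) = 0) (nhds p)"
    by (rule eventually_compose_filterlim)
  then show ?thesis by simp
qed

lemma analytic_germ_component:
  fixes \<gamma> :: "real \<Rightarrow> real^3"
  assumes "real_analytic \<gamma>"
  shows "analytic_germ (\<lambda>s. \<gamma> s $ i) p"
proof -
  obtain r a where r: "r > 0" and a: "\<And>s. \<bar>s - p\<bar> < r \<Longrightarrow> (\<lambda>k. (s - p) ^ k *\<^sub>R a k) sums \<gamma> s"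
    using assms unfolding real_analytic_def by blast
  define F where "F = Abs_fps (\<lambda>k. a k $ i)"
  have sums: "(\<lambda>k. fps_nth F k * t ^ k) sums (\<gamma> (p + t) $ i)" if "\<bar>t\<bar> < r" for t
    using bounded_linear.sums[OF bounded_linear_vec_nth a[of "p + t"], of i] that
    by (simp add: F_def mult.commute)
  \<comment> \<open>Convergence at the single point \<open>r / 2\<close> already bounds the radius
    of convergence below by \<open>r / 2\<close>.\<close>
  have "ereal (norm (r / 2)) \<le> fps_conv_radius F"
    unfolding fps_conv_radius_def
    using sums[of "r / 2"] r by (intro conv_radius_geI) (auto simp: sums_iff)
  moreover have "0 < ereal (norm (r / 2))"
    using r by simp
  ultimately have "fps_conv_radius F > 0"
    by (rule less_le_trans[rotated])
  moreover have "eventually (\<lambda>t. t \<in> {-r<..<r}) (nhds 0)"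
    using r by (intro eventually_nhds_in_open) auto
  then have "eventually (\<lambda>t. eval_fps F t = \<gamma> (p + t) $ i) (nhds 0)"
    by eventually_elim (use sums in \<open>auto simp: eval_fps_def sums_iff abs_less_iff\<close>)
  ultimately show ?thesis
    by (auto simp: analytic_germ_def has_fps_expansion_def)
qed

text \<open>Clearing the denominator \<open>\<kappa>\<^sup>2\<close> leaves a polynomial in the derivatives of \<open>\<gamma>\<close>.\<close>

lemma torsion_triple_product:
  assumes \<gamma>: "frenet_curve L \<gamma>"
  shows "cross3 (Dv \<gamma> s) (Dv (Dv \<gamma>) s) \<bullet> Dv (Dv (Dv \<gamma>)) s = (curvature \<gamma> s)\<^sup>2 * torsion \<gamma> s"
proof -
  have D1: "Dv \<gamma> = tangent \<gamma>"
    by (simp add: tangent_def)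
  have D2: "Dv (tangent \<gamma>) = (\<lambda>s. curvature \<gamma> s *\<^sub>R normal \<gamma> s)"
    by (simp add: fun_eq_iff Dv_tangent[OF \<gamma>])
  have "((\<lambda>s. curvature \<gamma> s *\<^sub>R normal \<gamma> s) has_vector_derivative
      curvature \<gamma> s *\<^sub>R Dv (normal \<gamma>) s + Dv (curvature \<gamma>) s *\<^sub>R normal \<gamma> s) (at s)"
    by (intro bounded_bilinear.has_vector_derivative[OF bounded_bilinear_scaleR]
        smooth_has_vector_derivative smooth_normal[OF \<gamma>] smooth_curvature[OF \<gamma>])
  then have D3: "Dv (\<lambda>s. curvature \<gamma> s *\<^sub>R normal \<gamma> s) s =
      curvature \<gamma> s *\<^sub>R Dv (normal \<gamma>) s + Dv (curvature \<gamma>) s *\<^sub>R normal \<gamma> s"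
    by (rule vector_derivative_at)
  show ?thesis
    using frame_inner[OF \<gamma>, of s]
    unfolding D1 Dv_curve[OF \<gamma>] D2 Dv_tangent[OF \<gamma>] D3
    by (simp add: cross_mult_right binormal_def[symmetric] Dv_normal[OF \<gamma>] inner_add_right
        inner_diff_right inner_commute power2_eq_square)
qed

text \<open>A power series is established only for \<open>?P\<close>, which avoids the square root
  in the curvature. Flatness of the torsion passes to \<open>?P\<close>, which then vanishes near
  the point, and division by the positive factor returns this to the torsion. By connectedness of
  the line either no point is flat or all are, giving one component or none.\<close>

lemma analytic_num_comps:
  assumes L: "L > 0" and \<gamma>: "frenet_curve L \<gamma>" and an: "real_analytic \<gamma>"
  shows "num_comps L (torsion \<gamma>) \<le>o cone"
proof -
  let ?P = "\<lambda>s. cross3 (Dv \<gamma> s) (Dv (Dv \<gamma>) s) \<bullet> Dv (Dv (Dv \<gamma>)) s"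
  have sm: "smooth \<gamma>"
    by (rule smooth_curve[OF \<gamma>])
  have germ: "analytic_germ (\<lambda>s. nth_deriv k \<gamma> s $ i) p" for k i p
  proof (induction k)
    case 0
    then show ?case using analytic_germ_component[OF an] by simp
  next
    case (Suc k)
    have sm': "smooth (\<lambda>s. nth_deriv k \<gamma> s $ i)"
      by (intro smooth_linear[OF bounded_linear_vec_nth] smooth_nth_deriv sm)
    have "(\<lambda>s. nth_deriv (Suc k) \<gamma> s $ i) = Dv (\<lambda>s. nth_deriv k \<gamma> s $ i)"
      using nth_deriv_linear[OF bounded_linear_vec_nth[of i] smooth_nth_deriv[OF sm, of k], of 1]
      by (simp add: nth_deriv_Suc)
    with analytic_germ_Dv[OF sm' Suc] show ?case by simp
  qed
  have P: "?P s = (curvature \<gamma> s * curvature \<gamma> s) * torsion \<gamma> s" for s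
    using torsion_triple_product[OF \<gamma>, of s] by (simp add: power2_eq_square)
  have germP: "analytic_germ ?P p" for p
  proof -
    note g = germ[of 1 _ p, unfolded One_nat_def nth_deriv_Suc nth_deriv_0]
      germ[of 2 _ p, unfolded nth_deriv_2]
      germ[of 3 _ p, unfolded numeral_3_eq_3 nth_deriv_Suc nth_deriv_0]
    show ?thesis
      unfolding inner_vec_def sum_3 cross_components inner_real_def
      by (intro analytic_germ_add analytic_germ_mult analytic_germ_diff g)
  qed
  have smk: "smooth (\<lambda>s. curvature \<gamma> s * curvature \<gamma> s)"
    by (intro smooth_bilinear[OF bounded_bilinear_mult] smooth_curvature[OF \<gamma>])
  have smP: "smooth ?P"
    unfolding P by (intro smooth_bilinear[OF bounded_bilinear_mult] smk smooth_torsion[OF \<gamma>])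
  have ev: "eventually (\<lambda>s. flat (torsion \<gamma>) s) (nhds p)" if "flat (torsion \<gamma>) p" for p
  proof -
    have "flat ?P p"
      unfolding P using that
      by (intro flat_bilinear[OF bounded_bilinear_mult] smk smooth_torsion[OF \<gamma>])
    then have "eventually (\<lambda>s. ?P s = 0) (nhds p)"
      using smP germP by (intro flat_analytic_germ)
    then have "eventually (\<lambda>s. torsion \<gamma> s = 0) (nhds p)"
      by eventually_elim (use curvature_pos[OF \<gamma>] in \<open>auto simp: P less_imp_neq[symmetric]\<close>)
    then have "eventually (\<lambda>t. eventually (\<lambda>s. torsion \<gamma> s = 0) (nhds t)) (nhds p)"
      by (simp add: eventually_eventually)
    then show ?thesis
      by eventually_elim (rule eventually_zero_flat[OF smooth_torsion[OF \<gamma>]])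
  qed
  have "open {s. flat (torsion \<gamma>) s}"
    unfolding open_subopen[of "{s. flat (torsion \<gamma>) s}"]
    using ev[unfolded eventually_nhds] by (metis mem_Collect_eq subsetI)
  moreover have "closed {s. flat (torsion \<gamma>) s}"
    by (rule closed_flat_set[OF smooth_torsion[OF \<gamma>]])
  ultimately have "{s. flat (torsion \<gamma>) s} = {} \<or> {s. flat (torsion \<gamma>) s} = UNIV"
    unfolding clopen[symmetric] by simp
  then show ?thesis
  proof
    assume "{s. flat (torsion \<gamma>) s} = {}"
    then show ?thesis
      by (intro num_comps_no_flat_points) auto
  next
    assume "{s. flat (torsion \<gamma>) s} = UNIV"
    then have "S1 - Z_inf L (torsion \<gamma>) = {}"
      unfolding S1_minus_Z_inf[OF L periodic_torsion[OF \<gamma>]] by auto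
    then show ?thesis
      by (intro num_comps_ordLeq_cone) (simp only: connected_empty)
  qed
qed

section \<open>Fibres over the unsigned datum\<close>

text \<open>The determinant as index makes the bookkeeping multiplicative: composition multiplies
  indices, and the torsion of a moved curve is multiplied by the index.\<close>

definition motions :: "real \<Rightarrow> (real^3 \<Rightarrow> real^3) set" where
  "motions \<delta> = {\<lambda>x. Q *v x + a | Q a. orthogonal_matrix Q \<and> det Q = \<delta>}"

lemma motionsI: "orthogonal_matrix Q \<Longrightarrow> det Q = \<delta> \<Longrightarrow> (\<lambda>x. Q *v x + a) \<in> motions \<delta>"
  by (auto simp: motions_def)

lemma SE3_eq: "SE3 = motions 1"
  by (auto simp: SE3_def motions_def rotation_matrix_def)

lemma E3_eq: "E3 = motions 1 \<union> motions (- 1)"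
  using det_orthogonal_matrix by (fastforce simp: E3_def motions_def)

lemma motions_comp:
  assumes "g \<in> motions \<delta>" "h \<in> motions \<epsilon>"
  shows "g \<circ> h \<in> motions (\<delta> * \<epsilon>)"
proof -
  obtain Q a R b where Q: "orthogonal_matrix Q" "det Q = \<delta>" "g = (\<lambda>x. Q *v x + a)"
    and R: "orthogonal_matrix R" "det R = \<epsilon>" "h = (\<lambda>x. R *v x + b)"
    using assms by (auto simp: motions_def)
  have "g \<circ> h = (\<lambda>x. (Q ** R) *v x + (Q *v b + a))"
    by (simp add: Q R fun_eq_iff matrix_vector_right_distrib matrix_vector_mul_assoc[symmetric])
  with Q R show ?thesis
    by (simp add: motionsI orthogonal_matrix_mul det_mul)
qed

lemma motions_inverse:
  assumes "g \<in> motions \<delta>"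
  obtains h where "h \<in> motions \<delta>" "\<And>x. h (g x) = x"
proof -
  obtain Q a where Q: "orthogonal_matrix Q" "det Q = \<delta>" "g = (\<lambda>x. Q *v x + a)"
    using assms by (auto simp: motions_def)
  let ?h = "\<lambda>x. transpose Q *v x + (- (transpose Q *v a))"
  have "?h \<in> motions \<delta>"
    using Q by (intro motionsI) (simp_all add: det_transpose)
  moreover have "?h (g x) = x" for x
    using Q by (simp add: matrix_vector_right_distrib matrix_vector_mul_assoc orthogonal_matrix)
  ultimately show ?thesis
    using that by blast
qed

lemma id_in_motions: "id \<in> motions 1"
  using motionsI[of "mat 1" 1 0] by (simp add: orthogonal_matrix_id id_def)

lemma SE3_comp: "g \<in> SE3 \<Longrightarrow> h \<in> SE3 \<Longrightarrow> g \<circ> h \<in> SE3"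
  unfolding SE3_eq using motions_comp[of g 1 h 1] by simp

lemma frenet_motion:
  assumes "g \<in> motions \<delta>" "frenet_curve L \<alpha>"
  shows "frenet_curve L (g \<circ> \<alpha>)" "curvature (g \<circ> \<alpha>) = curvature \<alpha>"
    "torsion (g \<circ> \<alpha>) = (\<lambda>s. \<delta> * torsion \<alpha> s)"
proof -
  obtain Q a where Q: "orthogonal_matrix Q" "det Q = \<delta>" "g = (\<lambda>x. Q *v x + a)"
    using assms by (auto simp: motions_def)
  have "g \<circ> \<alpha> = (\<lambda>s. Q *v \<alpha> s + a)"
    by (auto simp: Q)
  then show "frenet_curve L (g \<circ> \<alpha>)" "curvature (g \<circ> \<alpha>) = curvature \<alpha>"
      "torsion (g \<circ> \<alpha>) = (\<lambda>s. \<delta> * torsion \<alpha> s)"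
    using isometry_frenet[OF assms(2) Q(1)] Q(2) by simp_all
qed

lemma reflect_in_motions:
  assumes "norm n = 1"
  shows "reflect n \<in> motions (- 1)"
proof -
  have "reflect n = (\<lambda>x. reflect_matrix n *v x + 0)"
    by (simp add: fun_eq_iff reflect_matrix_works)
  then show ?thesis
    using motionsI orthogonal_reflect_matrix[OF assms] det_reflect_matrix[OF assms] by metis
qed

lemma reflect_in_reflections:
  assumes "norm n = 1"
  shows "reflect n \<in> reflections"
proof -
  have "reflect n = (\<lambda>x. x - (2 * ((x - 0) \<bullet> n)) *\<^sub>R n)"
    by (simp add: fun_eq_iff reflect_def)
  then show ?thesis
    using assms unfolding reflections_def by blast
qed

lemma frenet_congruent:
  assumes "frenet_curve L \<alpha>" "frenet_curve L \<beta>" "curvature \<beta> = curvature \<alpha>" "torsion \<beta> = torsion \<alpha>"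
  obtains g where "g \<in> SE3" "\<beta> = g \<circ> \<alpha>"
proof -
  obtain Q a where Q: "rotation_matrix Q" "\<beta> = (\<lambda>s. Q *v \<alpha> s + a)"
    using frenet_uniqueness[OF assms] by blast
  then have "(\<lambda>x. Q *v x + a) \<in> SE3" "\<beta> = (\<lambda>x. Q *v x + a) \<circ> \<alpha>"
    by (auto simp: SE3_def)
  then show ?thesis
    using that by blast
qed

definition congruence :: "(real^3 \<Rightarrow> real^3) set \<Rightarrow> real \<Rightarrow> (real \<Rightarrow> real) \<times> (real \<Rightarrow> real)
    \<Rightarrow> (real \<Rightarrow> real^3) rel" where
  "congruence G L d = {(\<gamma>, \<gamma>'). \<gamma> \<in> Fib L d \<and> \<gamma>' \<in> Fib L d \<and> (\<exists>g\<in>G. \<gamma>' = g \<circ> \<gamma>)}"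

lemma Fib_mod_eq: "Fib_mod G L d = Fib L d // congruence G L d"
  by (simp add: Fib_mod_def congruence_def)

lemma equiv_congruence: "equiv (Fib L d) (congruence SE3 L d)"
proof (rule equivI)
  show "congruence SE3 L d \<subseteq> Fib L d \<times> Fib L d"
    by (auto simp: congruence_def)
  show "refl_on (Fib L d) (congruence SE3 L d)"
    using id_in_motions by (auto simp: refl_on_def congruence_def SE3_eq intro!: bexI[of _ id])
  show "sym (congruence SE3 L d)"
  proof (rule symI)
    fix \<alpha> \<beta> assume "(\<alpha>, \<beta>) \<in> congruence SE3 L d"
    then obtain g where g: "\<alpha> \<in> Fib L d" "\<beta> \<in> Fib L d" "g \<in> SE3" "\<beta> = g \<circ> \<alpha>"
      by (auto simp: congruence_def)
    obtain h where h: "h \<in> SE3" "\<And>x. h (g x) = x"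
      using g(3) motions_inverse unfolding SE3_eq by blast
    then have "\<alpha> = h \<circ> \<beta>"
      by (simp add: g fun_eq_iff)
    with g(1,2) h(1) show "(\<beta>, \<alpha>) \<in> congruence SE3 L d"
      by (auto simp: congruence_def)
  qed
  show "trans (congruence SE3 L d)"
  proof (rule transI)
    fix \<alpha> \<beta> \<gamma> assume "(\<alpha>, \<beta>) \<in> congruence SE3 L d" "(\<beta>, \<gamma>) \<in> congruence SE3 L d"
    then obtain g h where "\<alpha> \<in> Fib L d" "\<gamma> \<in> Fib L d" "g \<in> SE3" "h \<in> SE3" "\<gamma> = (h \<circ> g) \<circ> \<alpha>"
      by (auto simp: congruence_def o_assoc)
    then show "(\<alpha>, \<gamma>) \<in> congruence SE3 L d"
      unfolding congruence_def using SE3_comp by blast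
  qed
qed

text \<open>The torsion of a representative distinguishes the classes modulo orientation-preserving
  motions, and all its possible values are signed lifts.\<close>

lemma card_Fib_SE:
  assumes "snd d = (\<lambda>s. \<bar>\<tau> s\<bar>)"
  shows "|Fib_SE L d| \<le>o |signed_lifts L \<tau>|"
proof (rule card_of_ordLeqI[of "\<lambda>C. torsion (SOME \<alpha>. \<alpha> \<in> C)"])
  have rep: "(SOME \<alpha>. \<alpha> \<in> C) \<in> C" "(SOME \<alpha>. \<alpha> \<in> C) \<in> Fib L d" if "C \<in> Fib_SE L d" for C
  proof -
    have "C \<noteq> {}" "C \<subseteq> Fib L d"
      using that in_quotient_imp_non_empty[OF equiv_congruence] in_quotient_imp_subset[OF equiv_congruence]
      by (auto simp: Fib_mod_eq)
    then show "(SOME \<alpha>. \<alpha> \<in> C) \<in> C" "(SOME \<alpha>. \<alpha> \<in> C) \<in> Fib L d"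
      using some_in_eq by blast+
  qed
  show "torsion (SOME \<alpha>. \<alpha> \<in> C) \<in> signed_lifts L \<tau>" if "C \<in> Fib_SE L d" for C
    using rep(2)[OF that] assms smooth_torsion periodic_torsion
    by (auto simp: Fib_def signed_lifts_def)
  show "inj_on (\<lambda>C. torsion (SOME \<alpha>. \<alpha> \<in> C)) (Fib_SE L d)"
  proof (rule inj_onI)
    fix C D assume C: "C \<in> Fib_SE L d" and D: "D \<in> Fib_SE L d"
      and t: "torsion (SOME \<alpha>. \<alpha> \<in> C) = torsion (SOME \<alpha>. \<alpha> \<in> D)"
    let ?a = "SOME \<alpha>. \<alpha> \<in> C" and ?b = "SOME \<alpha>. \<alpha> \<in> D"
    have ab: "?a \<in> Fib L d" "?b \<in> Fib L d"
      using rep C D by blast+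
    then have "curvature ?b = curvature ?a" "frenet_curve L ?a" "frenet_curve L ?b"
      by (auto simp: Fib_def fun_eq_iff)
    then obtain g where "g \<in> SE3" "?b = g \<circ> ?a"
      using t frenet_congruent by metis
    with ab have "(?a, ?b) \<in> congruence SE3 L d"
      by (auto simp: congruence_def)
    then show "C = D"
      using quotient_eqI[OF equiv_congruence] C D rep(1) unfolding Fib_mod_eq by blast
  qed
qed

text \<open>Members of one class differ by a motion isotopic to the identity, so the knot type is a
  function of the class, and every knot type of the fibre is one of its values.\<close>

lemma card_knot_types: "|knot_types L d| \<le>o |Fib_SE L d|"
proof -
  have "knot_types L d \<subseteq> (\<lambda>C. knot_type (range (SOME \<alpha>. \<alpha> \<in> C))) ` Fib_SE L d"
  proof
    fix K assume "K \<in> knot_types L d"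
    then obtain \<alpha> where \<alpha>: "\<alpha> \<in> Fib L d" "K = knot_type (range \<alpha>)"
      by (auto simp: knot_types_def)
    let ?C = "congruence SE3 L d `` {\<alpha>}"
    have "\<alpha> \<in> ?C"
      using equiv_class_self[OF equiv_congruence \<alpha>(1)] .
    then have "(SOME \<beta>. \<beta> \<in> ?C) \<in> ?C"
      by (rule someI[of "\<lambda>\<beta>. \<beta> \<in> ?C"])
    then obtain g where g: "g \<in> SE3" "(SOME \<beta>. \<beta> \<in> ?C) = g \<circ> \<alpha>"
      by (auto simp: congruence_def)
    have "knot_type (range (SOME \<beta>. \<beta> \<in> ?C)) = K"
      unfolding g(2) image_comp[symmetric] \<alpha>(2)
      by (rule knot_type_isotopic[OF isotopic_to_id_SE3[OF g(1)]])
    moreover have "?C \<in> Fib_SE L d"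
      unfolding Fib_mod_eq by (rule quotientI[OF \<alpha>(1)])
    ultimately show "K \<in> (\<lambda>C. knot_type (range (SOME \<alpha>. \<alpha> \<in> C))) ` Fib_SE L d"
      by blast
  qed
  then show ?thesis
    by (rule ordLeq_transitive[OF card_of_mono1 card_of_image])
qed

text \<open>A single orientation-reversing motion between representatives suffices. Going from
  \<open>\<beta>\<close> back to \<open>\<alpha>\<close>, on to \<open>x\<close> and then through
  the mirror uses two reversing motions and one preserving motion, so the total lies in
  \<open>SE3\<close>.\<close>

lemma reflect_class:
  assumes n: "norm n = 1" and C: "C \<in> Fib_SE L d" and D: "D \<in> Fib_SE L d"
    and ab: "\<alpha> \<in> C" "\<beta> \<in> D" "h \<in> motions (- 1)" "\<beta> = h \<circ> \<alpha>" and x: "x \<in> C"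
  shows "reflect n \<circ> x \<in> D"
proof -
  have Fib: "x \<in> Fib L d" "\<beta> \<in> Fib L d"
    using in_quotient_imp_subset[OF equiv_congruence] C D ab x unfolding Fib_mod_eq by blast+
  have "(\<alpha>, x) \<in> congruence SE3 L d"
    using in_quotient_imp_in_rel[OF equiv_congruence] C ab x unfolding Fib_mod_eq by blast
  then obtain g where g: "g \<in> motions 1" "x = g \<circ> \<alpha>"
    by (auto simp: congruence_def SE3_eq)
  obtain h' where h': "h' \<in> motions (- 1)" "\<And>x. h' (h x) = x"
    using ab motions_inverse by blast
  have "reflect n \<circ> (g \<circ> h') \<in> motions (- 1 * (1 * - 1))"
    using reflect_in_motions[OF n] g(1) h'(1) by (intro motions_comp)
  moreover have "reflect n \<circ> x = (reflect n \<circ> (g \<circ> h')) \<circ> \<beta>"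
    by (simp add: fun_eq_iff g ab h')
  moreover have "reflect n \<circ> x \<in> Fib L d"
    using Fib(1) frenet_motion[OF reflect_in_motions[OF n], of L x] by (simp add: Fib_def)
  ultimately have "(\<beta>, reflect n \<circ> x) \<in> congruence SE3 L d"
    using Fib unfolding congruence_def SE3_eq by auto
  then show ?thesis
    using in_quotient_imp_closed[OF equiv_congruence] D ab(2) unfolding Fib_mod_eq by blast
qed

theorem theoremA:
  fixes L :: real and \<gamma> :: "real \<Rightarrow> real^3" and \<tau> :: "real \<Rightarrow> real"
    and d :: "(real \<Rightarrow> real) \<times> (real \<Rightarrow> real)"
  assumes "L > 0"
    and "frenet_curve L \<gamma>"
    and "\<tau> = torsion \<gamma>"
    and "d = (curvature \<gamma>, \<lambda>s. \<bar>\<tau> s\<bar>)"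
  shows
    "(bij_betw (apply_signs L \<tau>) (sign_functions (S1 - Z_inf L \<tau>)) (signed_lifts L \<tau>)
      \<and> |signed_lifts L \<tau>| =o ctwo ^c num_comps L \<tau>
      \<and> (signed_lifts L \<tau> = {\<tau>, \<lambda>s. - \<tau> s} \<longleftrightarrow> num_comps L \<tau> \<le>o cone))
     \<and>
     ( |Fib_SE L d| \<le>o ctwo ^c num_comps L \<tau>
      \<and> |knot_types L d| \<le>o ctwo ^c num_comps L \<tau>)
     \<and>
     ((num_comps L \<tau> \<le>o cone \<longrightarrow>
         (\<forall>\<gamma>' \<in> Fib L d. \<exists>Q a. orthogonal_matrix Q \<and> (\<forall>s. \<gamma>' s = Q *v \<gamma> s + a))
         \<and> |Fib_E L d| =o cone
         \<and> |Fib_SE L d| \<le>o ctwo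
         \<and> (\<forall>C \<in> Fib_SE L d. \<forall>C' \<in> Fib_SE L d. C \<noteq> C' \<longrightarrow>
              (\<exists>\<rho> \<in> reflections. (\<lambda>\<alpha>. \<rho> \<circ> \<alpha>) ` C = C' \<and> (\<lambda>\<alpha>. \<rho> \<circ> \<alpha>) ` C' = C)))
      \<and> ((\<forall>s. \<tau> s = 0 \<longrightarrow> zero_order \<tau> s < \<infinity>) \<longrightarrow> num_comps L \<tau> \<le>o cone)
      \<and> (real_analytic \<gamma> \<longrightarrow> num_comps L \<tau> \<le>o cone))"
proof -
  note L = assms(1) and \<gamma> = assms(2)
  have \<tau>: "smooth \<tau>" "periodic L \<tau>"
    using smooth_torsion[OF \<gamma>] periodic_torsion[OF \<gamma>] assms(3) by auto
  have bij: "bij_betw (apply_signs L \<tau>) (sign_functions (S1 - Z_inf L \<tau>)) (signed_lifts L \<tau>)"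
    by (rule bij_betw_apply_signs[OF L \<tau>])
  have "locally connected (S1 - Z_inf L \<tau>)"
    using openin_S1_minus_Z_inf[OF L \<tau>] locally_connected_sphere locally_open_subset by blast
  then have lifts: "|signed_lifts L \<tau>| =o ctwo ^c num_comps L \<tau>"
    unfolding num_comps_def
    using card_sign_functions card_of_ordIsoI[OF bij] ordIso_symmetric ordIso_transitive by blast
  have lifts_le: "|Fib_SE L d| \<le>o |signed_lifts L \<tau>|"
    by (rule card_Fib_SE) (simp add: assms(4))
  then have Fib_SE: "|Fib_SE L d| \<le>o ctwo ^c num_comps L \<tau>"
    using lifts ordLeq_ordIso_trans by blast
  then have knots: "|knot_types L d| \<le>o ctwo ^c num_comps L \<tau>"
    using card_knot_types ordLeq_transitive by blast
  have pair: "signed_lifts L \<tau> = {\<tau>, \<lambda>s. - \<tau> s} \<longleftrightarrow> num_comps L \<tau> \<le>o cone"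
    by (rule signed_lifts_pair_iff[OF L \<tau>])
  have \<gamma>_Fib: "\<gamma> \<in> Fib L d"
    using \<gamma> assms(3,4) by (simp add: Fib_def)
  have rigid: "(\<forall>\<gamma>' \<in> Fib L d. \<exists>Q a. orthogonal_matrix Q \<and> (\<forall>s. \<gamma>' s = Q *v \<gamma> s + a))
         \<and> |Fib_E L d| =o cone
         \<and> |Fib_SE L d| \<le>o ctwo
         \<and> (\<forall>C \<in> Fib_SE L d. \<forall>C' \<in> Fib_SE L d. C \<noteq> C' \<longrightarrow>
              (\<exists>\<rho> \<in> reflections. (\<lambda>\<alpha>. \<rho> \<circ> \<alpha>) ` C = C' \<and> (\<lambda>\<alpha>. \<rho> \<circ> \<alpha>) ` C' = C))"
    if "num_comps L \<tau> \<le>o cone"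
  proof (intro conjI)
    have two: "signed_lifts L \<tau> = {\<tau>, \<lambda>s. - \<tau> s}"
      using that pair by blast
    define n :: "real^3" where "n = axis 1 1"
    have n: "norm n = 1"
      by (simp add: n_def norm_axis_1)
    have congr: "\<exists>g \<in> E3. \<beta> = g \<circ> \<alpha>" if \<alpha>: "\<alpha> \<in> Fib L d" and \<beta>: "\<beta> \<in> Fib L d" for \<alpha> \<beta>
    proof -
      have ab: "frenet_curve L \<alpha>" "frenet_curve L \<beta>" "curvature \<beta> = curvature \<alpha>"
        using \<alpha> \<beta> by (auto simp: Fib_def fun_eq_iff)
      have "torsion \<alpha> \<in> signed_lifts L \<tau>" "torsion \<beta> \<in> signed_lifts L \<tau>"
        using \<alpha> \<beta> ab smooth_torsion periodic_torsion assms(4) by (auto simp: Fib_def signed_lifts_def)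
      \<comment> \<open>Both torsions are \<tau> or its negative, so they agree up to sign. The
        negative is written as a multiple by -1 to match the torsion of the reflected curve.\<close>
      then consider "torsion \<beta> = torsion \<alpha>" | "torsion \<beta> = (\<lambda>s. - 1 * torsion \<alpha> s)"
        unfolding two by (auto simp: fun_eq_iff)
      then show ?thesis
      proof cases
        case 1
        then show ?thesis
          using frenet_congruent[OF ab] by (metis E3_eq SE3_eq UnI1)
      next
        case 2
        \<comment> \<open>Reflecting \<open>\<alpha>\<close> first flips its torsion to that of
          \<open>\<beta>\<close> and keeps its curvature, so the reflected curve and
          \<open>\<beta>\<close> differ by a motion in \<open>SE3\<close>.\<close>
        note r = frenet_motion[OF reflect_in_motions[OF n] ab(1)]
        obtain g where g: "g \<in> SE3" "\<beta> = g \<circ> (reflect n \<circ> \<alpha>)"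
          using frenet_congruent[OF r(1) ab(2)] r(2,3) ab(3) 2 by metis
        have "g \<circ> reflect n \<in> motions (1 * - 1)"
          using g(1) reflect_in_motions[OF n] unfolding SE3_eq by (rule motions_comp)
        then show ?thesis
          using g(2) by (auto simp: E3_eq o_assoc)
      qed
    qed
    show "\<forall>\<gamma>' \<in> Fib L d. \<exists>Q a. orthogonal_matrix Q \<and> (\<forall>s. \<gamma>' s = Q *v \<gamma> s + a)"
      using congr[OF \<gamma>_Fib] by (fastforce simp: E3_def)
    have "congruence E3 L d `` {\<alpha>} = Fib L d" if "\<alpha> \<in> Fib L d" for \<alpha>
      using that congr[OF that] by (auto simp: congruence_def)
    then have "Fib_E L d = {Fib L d}"
      using \<gamma>_Fib unfolding Fib_mod_eq quotient_def by auto
    moreover have "bij_betw (\<lambda>_. ()) {Fib L d} {()}"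
      by (simp add: bij_betw_def)
    ultimately show "|Fib_E L d| =o cone"
      unfolding BNF_Cardinal_Arithmetic.cone_def using card_of_ordIsoI by metis
    have "{\<tau>, \<lambda>s. - \<tau> s} = (\<lambda>b. if b then \<tau> else (\<lambda>s. - \<tau> s)) ` (UNIV :: bool set)"
      by (auto simp: UNIV_bool)
    then have "|signed_lifts L \<tau>| \<le>o ctwo"
      unfolding two ctwo_def using card_of_image by metis
    with lifts_le show "|Fib_SE L d| \<le>o ctwo"
      by (rule ordLeq_transitive)
    show "\<forall>C \<in> Fib_SE L d. \<forall>C' \<in> Fib_SE L d. C \<noteq> C' \<longrightarrow>
              (\<exists>\<rho> \<in> reflections. (\<lambda>\<alpha>. \<rho> \<circ> \<alpha>) ` C = C' \<and> (\<lambda>\<alpha>. \<rho> \<circ> \<alpha>) ` C' = C)"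
    proof (intro ballI impI)
      fix C D assume C: "C \<in> Fib_SE L d" and D: "D \<in> Fib_SE L d" and "C \<noteq> D"
      have "C \<noteq> {}" "D \<noteq> {}"
        using in_quotient_imp_non_empty[OF equiv_congruence] C D unfolding Fib_mod_eq by blast+
      then obtain \<alpha> \<beta> where ab: "\<alpha> \<in> C" "\<beta> \<in> D"
        by blast
      have Fib: "\<alpha> \<in> Fib L d" "\<beta> \<in> Fib L d"
        using in_quotient_imp_subset[OF equiv_congruence] C D ab unfolding Fib_mod_eq by blast+
      obtain h where h: "h \<in> E3" "\<beta> = h \<circ> \<alpha>"
        using congr[OF Fib] by blast
      \<comment> \<open>Distinct classes rule out an orientation-preserving congruence, so
        \<open>h\<close> has determinant -1, and so has its inverse \<open>k\<close>; the same
        reflection therefore works in both directions.\<close>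
      have "h \<notin> SE3"
      proof
        assume "h \<in> SE3"
        with h Fib have "(\<alpha>, \<beta>) \<in> congruence SE3 L d"
          by (auto simp: congruence_def)
        then show False
          using quotient_eqI[OF equiv_congruence] C D ab \<open>C \<noteq> D\<close> unfolding Fib_mod_eq by blast
      qed
      then have h': "h \<in> motions (- 1)"
        using h(1) by (auto simp: E3_eq SE3_eq)
      then obtain k where k: "k \<in> motions (- 1)" "\<And>x. k (h x) = x"
        using motions_inverse by blast
      have "\<alpha> = k \<circ> \<beta>"
        by (simp add: h k fun_eq_iff)
      then have CD: "reflect n \<circ> x \<in> D" if "x \<in> C" for x
        using reflect_class[OF n C D ab h' h(2) that] by blast
      have DC: "reflect n \<circ> x \<in> C" if "x \<in> D" for x
        using reflect_class[OF n D C ab(2,1) k(1) \<open>\<alpha> = k \<circ> \<beta>\<close> that] .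
      have img: "(\<lambda>\<alpha>. reflect n \<circ> \<alpha>) ` A = B"
        if "\<And>x. x \<in> A \<Longrightarrow> reflect n \<circ> x \<in> B" "\<And>x. x \<in> B \<Longrightarrow> reflect n \<circ> x \<in> A"
        for A B :: "(real \<Rightarrow> real^3) set"
      proof
        show "B \<subseteq> (\<lambda>\<alpha>. reflect n \<circ> \<alpha>) ` A"
        proof
          fix x assume "x \<in> B"
          then show "x \<in> (\<lambda>\<alpha>. reflect n \<circ> \<alpha>) ` A"
            by (intro image_eqI[of _ _ "reflect n \<circ> x"] that(2))
              (simp_all add: fun_eq_iff reflect_reflect[OF n])
        qed
      qed (use that(1) in blast)
      have "(\<lambda>\<alpha>. reflect n \<circ> \<alpha>) ` C = D" "(\<lambda>\<alpha>. reflect n \<circ> \<alpha>) ` D = C"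
        by (rule img; fact CD DC)+
      then show "\<exists>\<rho> \<in> reflections. (\<lambda>\<alpha>. \<rho> \<circ> \<alpha>) ` C = D \<and> (\<lambda>\<alpha>. \<rho> \<circ> \<alpha>) ` D = C"
        using reflect_in_reflections[OF n] by blast
    qed
  qed
  have finite_order: "num_comps L \<tau> \<le>o cone" if "\<forall>s. \<tau> s = 0 \<longrightarrow> zero_order \<tau> s < \<infinity>"
    using that not_flat_zero_order flat_zero by (intro num_comps_no_flat_points) blast
  have analytic: "num_comps L \<tau> \<le>o cone" if "real_analytic \<gamma>"
    unfolding assms(3) by (rule analytic_num_comps[OF L \<gamma> that])
  show ?thesis
    using bij lifts pair Fib_SE knots rigid finite_order analytic by blast
qed

end
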